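(* Let $R=\mathbb{C}[x,y,z,w]$ and let $I_4\subseteq R$ be the ideal generated by $$(x^4-y^4)(z^4-w^4)xy,\ (x^4-y^4)(z^4-w^4)zw,\ (x^4-z^4)(y^4-w^4)xz,\ (x^4-z^4)(y^4-w^4)yw,\ (x^4-w^4)(y^4-z^4)xw,\ (x^4-w^4)(y^4-z^4)yz.$$ Then $\alpha(I_4^{(m)})=8m$ for all integers $m\ge 3$ with $m\neq 5$.
   Context: For a homogeneous ideal $I$, $\alpha(I)$ denotes the least degree of a nonzero homogeneous element of $I$. The $m$-th symbolic power is $I^{(m)}=\bigcap_{\mathfrak p\in \operatorname{Ass}(R/I)} (I^mR_{\mathfrak p}\cap R)$. *)

theory Defs
  imports Complex_Main "HOL-Library.Poly_Mapping" "HOL-Library.Product_Plus"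
begin

type_synonym mon4 = "nat \<times> nat \<times> nat \<times> nat"
type_synonym R4 = "mon4 \<Rightarrow>\<^sub>0 complex"

definition varx :: R4 where "varx = Poly_Mapping.single (1,0,0,0) 1"
definition vary :: R4 where "vary = Poly_Mapping.single (0,1,0,0) 1"
definition varz :: R4 where "varz = Poly_Mapping.single (0,0,1,0) 1"
definition varw :: R4 where "varw = Poly_Mapping.single (0,0,0,1) 1"

definition mdeg :: "mon4 \<Rightarrow> nat" where
  "mdeg e = (case e of (a,b,c,d) \<Rightarrow> a + b + c + d)"

definition homogeneous_of_degree :: "R4 \<Rightarrow> nat \<Rightarrow> bool" where
  "homogeneous_of_degree f d \<longleftrightarrow> (\<forall>e \<in> Poly_Mapping.keys f. mdeg e = d)"

definition alpha :: "R4 set \<Rightarrow> nat" where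
  "alpha J = (LEAST d. \<exists>f \<in> J. f \<noteq> 0 \<and> homogeneous_of_degree f d)"

definition ideal_gen :: "'a::comm_ring_1 set \<Rightarrow> 'a set" where
  "ideal_gen S = {x. \<exists>F c. finite F \<and> F \<subseteq> S \<and> x = (\<Sum>g\<in>F. c g * g)}"

definition is_ideal :: "'a::comm_ring_1 set \<Rightarrow> bool" where
  "is_ideal I \<longleftrightarrow> 0 \<in> I \<and> (\<forall>a\<in>I. \<forall>b\<in>I. a + b \<in> I) \<and> (\<forall>r a. a \<in> I \<longrightarrow> r * a \<in> I)"

definition prime_ideal :: "'a::comm_ring_1 set \<Rightarrow> bool" where
  "prime_ideal P \<longleftrightarrow> is_ideal P \<and> P \<noteq> UNIV \<and> (\<forall>a b. a * b \<in> P \<longrightarrow> a \<in> P \<or> b \<in> P)"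

definition ideal_mult :: "'a::comm_ring_1 set \<Rightarrow> 'a set \<Rightarrow> 'a set" where
  "ideal_mult I J = ideal_gen {a * b | a b. a \<in> I \<and> b \<in> J}"

fun ideal_pow :: "'a::comm_ring_1 set \<Rightarrow> nat \<Rightarrow> 'a set" where
  "ideal_pow I 0 = UNIV"
| "ideal_pow I (Suc n) = ideal_mult I (ideal_pow I n)"

definition ideal_colon :: "'a::comm_ring_1 set \<Rightarrow> 'a \<Rightarrow> 'a set" where
  "ideal_colon I f = {r. r * f \<in> I}"

definition associated_primes :: "'a::comm_ring_1 set \<Rightarrow> 'a set set" where
  "associated_primes I = {P. prime_ideal P \<and> (\<exists>f. P = ideal_colon I f)}"

text \<open>Contraction of the extension J R_P back to R: {r. exists s notin P, s r in J}.\<close>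
definition loc_contract :: "'a::comm_ring_1 set \<Rightarrow> 'a set \<Rightarrow> 'a set" where
  "loc_contract J P = {r. \<exists>s. s \<notin> P \<and> s * r \<in> J}"

definition symbolic_power :: "'a::comm_ring_1 set \<Rightarrow> nat \<Rightarrow> 'a set" where
  "symbolic_power I m = (\<Inter>P \<in> associated_primes I. loc_contract (ideal_pow I m) P)"

definition I4 :: "R4 set" where
  "I4 = ideal_gen
    { (varx^4 - vary^4) * (varz^4 - varw^4) * varx * vary,
      (varx^4 - vary^4) * (varz^4 - varw^4) * varz * varw,
      (varx^4 - varz^4) * (vary^4 - varw^4) * varx * varz,
      (varx^4 - varz^4) * (vary^4 - varw^4) * vary * varw,
      (varx^4 - varw^4) * (vary^4 - varz^4) * varx * varw,
      (varx^4 - varw^4) * (vary^4 - varz^4) * vary * varz }"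

end

(* Write X = x^4 etc. and A = (X-Y)(Z-W), B = (X-Z)(Y-W), C = (X-W)(Y-Z), so that A = B - C.

   Upper bound: A^a B^b C^c with a + b + c = m and 4a, 4b, 4c >= m has degree 8m and lies in the
   symbolic power. At an associated prime P containing at most one variable, A, B and C lie in the
   localised ideal; if P contains exactly the variables x, y, then B is a unit at P, so x and y lie
   in the localised ideal and A in its fourth power (similarly for the other pairs). No associated
   prime contains three variables: every syzygy of (B, C) is a multiple of (C, -B), which reduces
   membership of Bp + Cq in the ideal to a condition on the monomials of p and q.

   Lower bound: only the 64 lines in the orbit of x = y = z under permutations and scalings by
   fourth roots of unity are needed. A form of degree d < 8m vanishing to order m along all of them
   vanishes on the plane x = y, which contains eight of the lines, hence on all 24 planes of the
   orbit. So it is divisible by ABC, which vanishes to order exactly 3 along each line, and the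
   quotient has degree d - 24 < 8(m - 3) and vanishes to order m - 3. *)
theory Submission
  imports Defs "HOL-Library.Product_Lexorder" "HOL-Computational_Algebra.Factorial_Ring"
begin

subsection \<open>Substitution in polynomials\<close>

text \<open>The lexicographic order makes exponent vectors a linearly ordered cancellative monoid,
  and hence \<open>R4\<close> an integral domain.\<close>

instance prod :: (linordered_cancel_ab_semigroup_add, linordered_cancel_ab_semigroup_add)
  ordered_cancel_ab_semigroup_add
  by standard (auto simp: less_eq_prod_def plus_prod_def)

instance prod :: ("{linordered_cancel_ab_semigroup_add, comm_monoid_add}",
    "{linordered_cancel_ab_semigroup_add, comm_monoid_add}") ordered_cancel_comm_monoid_add ..

instance prod :: (linordered_cancel_ab_semigroup_add, linordered_cancel_ab_semigroup_add)
  linordered_cancel_ab_semigroup_add ..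

definition const4 :: "complex \<Rightarrow> R4" where
  "const4 c = Poly_Mapping.single 0 c"

definition monom4 :: "mon4 \<Rightarrow> R4" where
  "monom4 e = Poly_Mapping.single e 1"

lemma const4_simps [simp]:
  "const4 0 = 0" "const4 1 = 1"
  "const4 (a + b) = const4 a + const4 b" "const4 (a * b) = const4 a * const4 b"
  "const4 (- a) = - const4 a" "const4 (a - b) = const4 a - const4 b"
  "const4 (numeral k) = numeral k"
  by (simp_all add: const4_def single_add mult_single single_uminus single_diff)

lemma const4_power [simp]: "const4 (a ^ n) = const4 a ^ n"
  by (induction n) simp_all

lemma const4_eq_iff [simp]: "const4 a = const4 b \<longleftrightarrow> a = b"
  unfolding const4_def by (metis lookup_single_eq)

lemma const4_eq_0_iff [simp]: "const4 a = 0 \<longleftrightarrow> a = 0"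
  using const4_eq_iff [of a 0] by simp

lemma single_conv_monom4: "Poly_Mapping.single e c = const4 c * monom4 e"
  by (simp add: const4_def monom4_def mult_single)

lemma zero_mon4: "(0 :: mon4) = (0, 0, 0, 0)"
  by (simp add: zero_prod_def)

lemma monom4_0 [simp]: "monom4 0 = 1" "monom4 (0, 0, 0, 0) = 1"
  by (simp_all add: monom4_def zero_mon4 [symmetric])

lemma monom4_add: "monom4 (e + e') = monom4 e * monom4 e'"
  by (simp add: monom4_def mult_single)

lemma monom4_conv_var: "monom4 (i, j, k, l) = varx ^ i * vary ^ j * varz ^ k * varw ^ l"
proof -
  have "varx ^ n = monom4 (n, 0, 0, 0)" "vary ^ n = monom4 (0, n, 0, 0)"
       "varz ^ n = monom4 (0, 0, n, 0)" "varw ^ n = monom4 (0, 0, 0, n)" for n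
    by (induction n) (auto simp: varx_def vary_def varz_def varw_def monom4_def mult_single zero_mon4 [symmetric])
  then show ?thesis
    by (simp add: monom4_add [symmetric])
qed

lemma R4_sum_monom: "f = (\<Sum>e\<in>Poly_Mapping.keys f. const4 (Poly_Mapping.lookup f e) * monom4 e)"
  by (rule poly_mapping_eqI)
     (auto simp: lookup_sum lookup_single when_def in_keys_iff single_conv_monom4 [symmetric])

lemma R4_monom_induct [case_names monom add]:
  fixes f :: R4
  assumes "\<And>e c. P (const4 c * monom4 e)" and "\<And>f g. P f \<Longrightarrow> P g \<Longrightarrow> P (f + g)"
  shows "P f"
proof -
  have "P (\<Sum>e\<in>K. const4 (Poly_Mapping.lookup f e) * monom4 e)" if "finite K" for K
    using that
  proof (induction K rule: finite_induct)
    case empty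
    show ?case using assms(1)[of 0] by simp
  qed (auto intro: assms)
  then show ?thesis
    by (subst R4_sum_monom) auto
qed

lemma R4_induct [case_names const x y z w add mult]:
  fixes f :: R4
  assumes "\<And>c. P (const4 c)" and "P varx" "P vary" "P varz" "P varw"
    and "\<And>f g. P f \<Longrightarrow> P g \<Longrightarrow> P (f + g)" and "\<And>f g. P f \<Longrightarrow> P g \<Longrightarrow> P (f * g)"
  shows "P f"
proof (induction f rule: R4_monom_induct)
  case (monom e c)
  have "P (v ^ n)" if "P v" for v n
    using assms(1)[of 1] that by (induction n) (auto intro: assms(7))
  then show ?case
    using assms by (cases e) (auto simp: monom4_conv_var)
qed (use assms in auto)

text \<open>The algebra endomorphism sending the four variables to \<open>a\<close>,
  \<open>b\<close>, \<open>c\<close>, \<open>d\<close>. Symmetries, restrictions to planes and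
  lines, evaluation at points and the blow-up chart are all instances.\<close>

definition subst4 :: "R4 \<Rightarrow> R4 \<Rightarrow> R4 \<Rightarrow> R4 \<Rightarrow> R4 \<Rightarrow> R4" where
  "subst4 a b c d f = (\<Sum>e\<in>Poly_Mapping.keys f. const4 (Poly_Mapping.lookup f e) *
     (case e of (i, j, k, l) \<Rightarrow> a ^ i * b ^ j * c ^ k * d ^ l))"

lemma subst4_superset:
  assumes "finite K" "Poly_Mapping.keys f \<subseteq> K"
  shows "subst4 a b c d f = (\<Sum>e\<in>K. const4 (Poly_Mapping.lookup f e) *
     (case e of (i, j, k, l) \<Rightarrow> a ^ i * b ^ j * c ^ k * d ^ l))"
  unfolding subst4_def using assms
  by (intro sum.mono_neutral_left) (auto simp: in_keys_iff)

lemma subst4_monom: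
  "subst4 a b c d (const4 u * monom4 (i, j, k, l)) = const4 u * (a ^ i * b ^ j * c ^ k * d ^ l)"
  by (subst subst4_superset[of "{(i, j, k, l)}"])
     (auto simp: in_keys_iff lookup_single when_def single_conv_monom4 [symmetric] split: if_splits)

lemma subst4_add [simp]: "subst4 a b c d (f + g) = subst4 a b c d f + subst4 a b c d g"
proof -
  let ?K = "Poly_Mapping.keys f \<union> Poly_Mapping.keys g"
  have "Poly_Mapping.keys (f + g) \<subseteq> ?K" by (rule keys_add)
  then show ?thesis
    by (simp add: subst4_superset[of ?K] lookup_add algebra_simps sum.distrib)
qed

lemma subst4_mult [simp]: "subst4 a b c d (f * g) = subst4 a b c d f * subst4 a b c d g"
proof (induction f rule: R4_monom_induct)
  case (monom e u)
  show ?case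
  proof (induction g rule: R4_monom_induct)
    case (monom e' v)
    obtain i j k l where e: "e = (i, j, k, l)" by (cases e)
    obtain i' j' k' l' where e': "e' = (i', j', k', l')" by (cases e')
    have "const4 u * monom4 e * (const4 v * monom4 e') = const4 (u * v) * monom4 (e + e')"
      by (simp add: monom4_add algebra_simps)
    then show ?case
      unfolding e e' add_Pair by (simp only: subst4_monom) (simp add: power_add algebra_simps)
  qed (simp add: algebra_simps)
qed (simp add: algebra_simps)

lemma subst4_const [simp]: "subst4 a b c d (const4 u) = const4 u"
  using subst4_monom[of a b c d u 0 0 0 0] by simp

lemma subst4_var [simp]:
  "subst4 a b c d varx = a" "subst4 a b c d vary = b"
  "subst4 a b c d varz = c" "subst4 a b c d varw = d"
  using subst4_monom[of a b c d 1 1 0 0 0] subst4_monom[of a b c d 1 0 1 0 0]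
    subst4_monom[of a b c d 1 0 0 1 0] subst4_monom[of a b c d 1 0 0 0 1]
  by (simp_all add: monom4_conv_var)

lemma subst4_0 [simp]: "subst4 a b c d 0 = 0"
  and subst4_1 [simp]: "subst4 a b c d 1 = 1"
  and subst4_numeral [simp]: "subst4 a b c d (numeral n) = numeral n"
  using subst4_const[of a b c d 0] subst4_const[of a b c d 1] subst4_const[of a b c d "numeral n"]
  by (simp_all del: subst4_const)

lemma subst4_uminus [simp]: "subst4 a b c d (- f) = - subst4 a b c d f"
  using subst4_add[of a b c d f "- f"] by (simp del: subst4_add add: eq_neg_iff_add_eq_0 add.commute)

lemma subst4_diff [simp]: "subst4 a b c d (f - g) = subst4 a b c d f - subst4 a b c d g"
  using subst4_add[of a b c d f "- g"] by (simp del: subst4_add)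

lemma subst4_power [simp]: "subst4 a b c d (f ^ n) = subst4 a b c d f ^ n"
  by (induction n) auto

lemma subst4_id [simp]: "subst4 varx vary varz varw f = f"
  by (induction f rule: R4_induct) auto

lemma subst4_subst4:
  "subst4 a b c d (subst4 p q r s f) =
   subst4 (subst4 a b c d p) (subst4 a b c d q) (subst4 a b c d r) (subst4 a b c d s) f"
  by (induction f rule: R4_induct) auto

section \<open>Divisibility by linear forms and by products of primes\<close>

lemma dvd_mult_diff:
  fixes l :: "'a::comm_ring_1"
  assumes "l dvd a - a'" "l dvd b - b'"
  shows "l dvd a * b - a' * b'"
proof -
  have "a * b - a' * b' = (a - a') * b + a' * (b - b')" by (simp add: algebra_simps)
  then show ?thesis using assms by auto
qed

lemma dvd_subst4_diff:
  assumes "l dvd a - a'" "l dvd b - b'" "l dvd c - c'" "l dvd d - d'"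
  shows "l dvd subst4 a b c d f - subst4 a' b' c' d' f"
proof (induction f rule: R4_induct)
  case (add f g)
  then show ?case using dvd_add by (fastforce simp: algebra_simps)
qed (use assms in \<open>auto intro: dvd_mult_diff\<close>)

text \<open>The substitution fixes every variable modulo \<open>l\<close> and kills
  \<open>l\<close>, so its kernel is the principal ideal of \<open>l\<close>. Divisibility by a
  linear form thus becomes a computation.\<close>

lemma dvd_iff_subst4_eq_0:
  assumes "l dvd varx - a" "l dvd vary - b" "l dvd varz - c" "l dvd varw - d"
    and "subst4 a b c d l = 0"
  shows "l dvd f \<longleftrightarrow> subst4 a b c d f = 0"
proof
  assume "l dvd f"
  then obtain h where "f = l * h" by (elim dvdE)
  then show "subst4 a b c d f = 0" using assms(5) by simp
next
  assume "subst4 a b c d f = 0"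
  then show "l dvd f" using dvd_subst4_diff[OF assms(1-4), of f] by simp
qed

text \<open>\<open>l\<close> generates the kernel of a homomorphism into an integral domain.\<close>

lemma prime_elem_subst4:
  assumes "l dvd varx - a" "l dvd vary - b" "l dvd varz - c" "l dvd varw - d"
    and "subst4 a b c d l = 0" and "l \<noteq> 0"
  shows "prime_elem l"
  unfolding prime_elem_def dvd_iff_subst4_eq_0[OF assms(1-5)] using assms(6)
  by simp

text \<open>The primes are split off one at a time: each divides \<open>p\<close> because it misses
  \<open>q\<close>. Repetitions in the list cover powers of primes.\<close>

lemma prod_list_dvd_cancel:
  fixes p q :: "'a::idom"
  assumes "\<And>l. l \<in> set ls \<Longrightarrow> prime_elem l \<and> \<not> l dvd q" and "prod_list ls dvd p * q"
  shows "prod_list ls dvd p"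
  using assms
proof (induction ls arbitrary: p)
  case (Cons l ls)
  have l: "prime_elem l" "\<not> l dvd q" using Cons.prems(1)[of l] by simp_all
  have "l dvd p * q" using Cons.prems(2) by (metis dvd_mult_left prod_list.Cons)
  then have "l dvd p" using l by (simp add: prime_elem_dvd_mult_iff)
  then obtain p' where p': "p = l * p'" by (elim dvdE)
  have "l * prod_list ls dvd l * (p' * q)" using Cons.prems(2) by (simp add: p' mult_ac)
  moreover have "l \<noteq> 0" using l(1) by (rule prime_elem_not_zeroI)
  ultimately have "prod_list ls dvd p' * q" by simp
  then have "prod_list ls dvd p'"
    by (rule Cons.IH[rotated]) (simp add: Cons.prems(1))
  then show ?case by (simp add: p')
qed auto

lemma prod_list_mult_dvd:
  fixes p q :: "'a::idom"
  assumes "\<And>l. l \<in> set ls \<Longrightarrow> prime_elem l \<and> \<not> l dvd q" and "prod_list ls dvd f" "q dvd f"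
  shows "prod_list ls * q dvd f"
proof -
  obtain h where h: "f = q * h" using assms(3) by (elim dvdE)
  have "prod_list ls dvd h"
    using prod_list_dvd_cancel[of ls q h] assms h by (simp add: mult.commute)
  then show ?thesis by (simp add: h mult.commute)
qed

subsection \<open>Ideals and their powers\<close>

lemma is_idealD:
  assumes "is_ideal I"
  shows "0 \<in> I" "a \<in> I \<Longrightarrow> b \<in> I \<Longrightarrow> a + b \<in> I" "a \<in> I \<Longrightarrow> r * a \<in> I"
    "a \<in> I \<Longrightarrow> a * r \<in> I" "a \<in> I \<Longrightarrow> - a \<in> I" "a \<in> I \<Longrightarrow> b \<in> I \<Longrightarrow> a - b \<in> I"
proof -
  show *: "0 \<in> I" "a \<in> I \<Longrightarrow> b \<in> I \<Longrightarrow> a + b \<in> I" "a \<in> I \<Longrightarrow> r * a \<in> I" for a b r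
    using assms by (auto simp: is_ideal_def)
  show "a \<in> I \<Longrightarrow> a * r \<in> I"
    using *(3)[of a r] by (simp add: mult.commute)
  show neg: "a \<in> I \<Longrightarrow> - a \<in> I" for a
    using *(3)[of a "- 1"] by simp
  show "a \<in> I \<Longrightarrow> b \<in> I \<Longrightarrow> a - b \<in> I"
    using *(2)[OF _ neg, of a b] by simp
qed

lemma is_ideal_sum:
  assumes "is_ideal I" and "\<And>x. x \<in> A \<Longrightarrow> f x \<in> I"
  shows "sum f A \<in> I"
  using assms(2) by (induction A rule: infinite_finite_induct) (auto intro: is_idealD[OF assms(1)])

lemma ideal_gen_superset: "g \<in> S \<Longrightarrow> g \<in> ideal_gen S"
  unfolding ideal_gen_def by (auto intro!: exI[of _ "{g}"] exI[of _ "\<lambda>_. 1"])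

lemma is_ideal_ideal_gen: "is_ideal (ideal_gen S)"
  unfolding is_ideal_def
proof (intro conjI ballI allI impI)
  show "0 \<in> ideal_gen S"
    unfolding ideal_gen_def by (auto intro!: exI[of _ "{}"])
next
  fix a b assume "a \<in> ideal_gen S" "b \<in> ideal_gen S"
  then obtain F c G d where *: "finite F" "F \<subseteq> S" "a = (\<Sum>g\<in>F. c g * g)"
      "finite G" "G \<subseteq> S" "b = (\<Sum>g\<in>G. d g * g)"
    unfolding ideal_gen_def by blast
  have "a = (\<Sum>g\<in>F \<union> G. (if g \<in> F then c g else 0) * g)"
    unfolding * using * by (intro sum.mono_neutral_cong_left) auto
  moreover have "b = (\<Sum>g\<in>F \<union> G. (if g \<in> G then d g else 0) * g)"
    unfolding * using * by (intro sum.mono_neutral_cong_left) auto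
  ultimately have "a + b = (\<Sum>g\<in>F \<union> G. ((if g \<in> F then c g else 0) + (if g \<in> G then d g else 0)) * g)"
    by (simp add: sum.distrib algebra_simps)
  then show "a + b \<in> ideal_gen S"
    unfolding ideal_gen_def mem_Collect_eq using *
    by (intro exI[of _ "F \<union> G"] exI conjI) auto
next
  fix r a assume "a \<in> ideal_gen S"
  then obtain F c where *: "finite F" "F \<subseteq> S" "a = (\<Sum>g\<in>F. c g * g)"
    unfolding ideal_gen_def by blast
  then have "r * a = (\<Sum>g\<in>F. (r * c g) * g)"
    by (simp add: sum_distrib_left mult.assoc)
  then show "r * a \<in> ideal_gen S"
    unfolding ideal_gen_def mem_Collect_eq using *
    by (intro exI[of _ F] exI[of _ "\<lambda>g. r * c g"]) auto
qed

lemma ideal_gen_subset: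
  assumes "is_ideal J" "S \<subseteq> J"
  shows "ideal_gen S \<subseteq> J"
  unfolding ideal_gen_def using assms by (auto intro!: is_ideal_sum is_idealD(3))

lemma is_ideal_UNIV: "is_ideal UNIV"
  by (simp add: is_ideal_def)

lemma is_ideal_pow: "is_ideal (ideal_pow I n)"
  by (cases n) (auto simp: is_ideal_UNIV ideal_mult_def is_ideal_ideal_gen)

text \<open>Since products generate the powers, a single multiplication step has to be checked.
  Later choices of \<open>J\<close> are preimages under symmetries and vanishing orders along a
  line.\<close>

lemma ideal_pow_subset:
  assumes "J 0 = UNIV" "\<And>n. is_ideal (J n)"
    and "\<And>n a b. a \<in> I \<Longrightarrow> b \<in> J n \<Longrightarrow> a * b \<in> J (Suc n)"
  shows "ideal_pow I n \<subseteq> J n"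
proof (induction n)
  case (Suc n)
  have "{a * b |a b. a \<in> I \<and> b \<in> ideal_pow I n} \<subseteq> J (Suc n)"
    using Suc assms(3) by blast
  then show ?case
    by (simp add: ideal_mult_def ideal_gen_subset assms)
qed (simp add: assms)

lemma mult_in_ideal_pow_Suc:
  assumes "a \<in> I" "b \<in> ideal_pow I n"
  shows "a * b \<in> ideal_pow I (Suc n)"
  using assms by (auto simp: ideal_mult_def intro!: ideal_gen_superset)

lemma mult_in_ideal_pow_add:
  assumes "a \<in> ideal_pow I i" "b \<in> ideal_pow I j"
  shows "a * b \<in> ideal_pow I (i + j)"
proof -
  \<comment> \<open>For each \<open>i\<close> these multipliers form an ideal, so the preceding
    induction principle applies to them.\<close>
  let ?J = "\<lambda>i. {a. \<forall>b\<in>ideal_pow I j. a * b \<in> ideal_pow I (i + j)}"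
  have "ideal_pow I i \<subseteq> ?J i"
  proof (rule ideal_pow_subset[of ?J])
    show "is_ideal (?J n)" for n
      using is_idealD[OF is_ideal_pow[of I "n + j"]]
      by (auto simp: is_ideal_def distrib_right mult.assoc)
  qed (auto simp: mult.assoc mult_in_ideal_pow_Suc simp del: ideal_pow.simps(2)
         intro: is_idealD[OF is_ideal_pow])
  then show ?thesis using assms by blast
qed

lemma power_in_ideal_pow: "a \<in> I \<Longrightarrow> a ^ n \<in> ideal_pow I n"
  by (induction n) (auto simp: mult_in_ideal_pow_Suc simp del: ideal_pow.simps(2))

lemma power_in_ideal_pow_mult: "a \<in> ideal_pow I k \<Longrightarrow> a ^ n \<in> ideal_pow I (k * n)"
  by (induction n) (auto simp: mult_in_ideal_pow_add)

lemma ideal_pow_antimono: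
  assumes "i \<le> j"
  shows "ideal_pow I j \<subseteq> ideal_pow I i"
proof -
  have "ideal_pow I (i + k) \<subseteq> ideal_pow I i" for k
  proof (induction k)
    case (Suc k)
    have "{a * b |a b. a \<in> I \<and> b \<in> ideal_pow I (i + k)} \<subseteq> ideal_pow I i"
      using Suc by (auto intro: is_idealD[OF is_ideal_pow])
    then show ?case
      by (simp add: ideal_mult_def ideal_gen_subset is_ideal_pow)
  qed simp
  then show ?thesis using assms by (metis le_add_diff_inverse)
qed

subsection \<open>The ideal and its symmetries\<close>

definition pA :: R4 where "pA = (varx^4 - vary^4) * (varz^4 - varw^4)"
definition pB :: R4 where "pB = (varx^4 - varz^4) * (vary^4 - varw^4)"
definition pC :: R4 where "pC = (varx^4 - varw^4) * (vary^4 - varz^4)"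

lemmas pABC_defs = pA_def pB_def pC_def

lemma pA_eq: "pA = pB - pC"
  by (simp add: pABC_defs algebra_simps)

lemma is_ideal_I4: "is_ideal I4"
  unfolding I4_def by (rule is_ideal_ideal_gen)

lemma I4_gens:
  "pA * (varx * vary) \<in> I4" "pA * (varz * varw) \<in> I4" "pB * (varx * varz) \<in> I4"
  "pB * (vary * varw) \<in> I4" "pC * (varx * varw) \<in> I4" "pC * (vary * varz) \<in> I4"
  unfolding I4_def pABC_defs mult.assoc[symmetric] by (rule ideal_gen_superset; simp)+

lemma I4_subset:
  assumes "is_ideal J"
    "pA * (varx * vary) \<in> J" "pA * (varz * varw) \<in> J" "pB * (varx * varz) \<in> J"
    "pB * (vary * varw) \<in> J" "pC * (varx * varw) \<in> J" "pC * (vary * varz) \<in> J"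
  shows "I4 \<subseteq> J"
  unfolding I4_def using assms by (intro ideal_gen_subset) (auto simp: pABC_defs mult.assoc)

lemma I4_multiples:
  "pA * (varx * vary) * r \<in> I4" "pA * (varz * varw) * r \<in> I4" "pB * (varx * varz) * r \<in> I4"
  "pB * (vary * varw) * r \<in> I4" "pC * (varx * varw) * r \<in> I4" "pC * (vary * varz) * r \<in> I4"
  by (intro is_idealD(4)[OF is_ideal_I4] I4_gens)+

text \<open>Generators of the group of permutations of the variables and scalings by fourth roots of
  unity; transpositions carry the scaling of y to the other variables.\<close>

definition is_sym_gen :: "(R4 \<Rightarrow> R4) \<Rightarrow> bool" where
  "is_sym_gen h \<longleftrightarrow> h = subst4 vary varx varz varw \<or> h = subst4 varx varz vary varw \<or>
     h = subst4 varx vary varw varz \<or> (\<exists>u. u ^ 4 = 1 \<and> h = subst4 varx (const4 u * vary) varz varw)"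

lemma is_sym_gen_cases [consumes 1, case_names xy yz zw scale]:
  assumes "is_sym_gen h"
    and "h = subst4 vary varx varz varw \<Longrightarrow> P" and "h = subst4 varx varz vary varw \<Longrightarrow> P"
    and "h = subst4 varx vary varw varz \<Longrightarrow> P"
    and "\<And>u. u ^ 4 = 1 \<Longrightarrow> h = subst4 varx (const4 u * vary) varz varw \<Longrightarrow> P"
  shows P
  using assms unfolding is_sym_gen_def by blast

lemma is_sym_gen_hom:
  assumes "is_sym_gen h"
  shows "h (f + g) = h f + h g" "h (f * g) = h f * h g" "h 0 = 0" "h 1 = 1" "h (- f) = - h f"
  using assms by (auto elim!: is_sym_gen_cases)

text \<open>Transpositions are involutions, and scaling by \<open>u ^ 3\<close> undoes scaling by
  \<open>u\<close>.\<close>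

lemma is_sym_gen_inverse:
  assumes "is_sym_gen h"
  obtains h' where "is_sym_gen h'" "\<And>f. h (h' f) = f" "\<And>f. h' (h f) = f"
  using assms
proof (cases rule: is_sym_gen_cases)
  case xy
  then show ?thesis using assms by (intro that[of h]) (auto simp: subst4_subst4)
next
  case yz
  then show ?thesis using assms by (intro that[of h]) (auto simp: subst4_subst4)
next
  case zw
  then show ?thesis using assms by (intro that[of h]) (auto simp: subst4_subst4)
next
  case (scale u)
  have [simp]: "const4 u * (const4 u ^ 3 * f) = f" "const4 u ^ 3 * (const4 u * f) = f" for f
  proof -
    have "const4 u * const4 u ^ 3 = const4 (u ^ 4)" by (simp add: eval_nat_numeral)
    with scale(1) show "const4 u * (const4 u ^ 3 * f) = f" "const4 u ^ 3 * (const4 u * f) = f"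
      by (simp_all add: mult_ac)
  qed
  have "(u ^ 3) ^ 4 = (u ^ 4) ^ 3" by (simp add: power_mult [symmetric])
  then have "is_sym_gen (subst4 varx (const4 (u ^ 3) * vary) varz varw)"
    unfolding is_sym_gen_def using scale(1) by (intro disjI2 exI[of _ "u ^ 3"]) simp
  then show ?thesis
    by (rule that) (simp_all add: subst4_subst4 scale(2))
qed

text \<open>The three products belong to the three ways of pairing the variables. Transpositions
  permute these up to the sign of swapped differences, and fourth powers do not see the
  scaling.\<close>

lemma is_sym_gen_pABC:
  assumes "is_sym_gen h"
  obtains (xy) "h = subst4 vary varx varz varw" "h pA = - pA" "h pB = pC" "h pC = pB"
  | (yz) "h = subst4 varx varz vary varw" "h pA = pB" "h pB = pA" "h pC = - pC"
  | (zw) "h = subst4 varx vary varw varz" "h pA = - pA" "h pB = pC" "h pC = pB"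
  | (scale) u where "h = subst4 varx (const4 u * vary) varz varw" "h pA = pA" "h pB = pB" "h pC = pC"
  using assms
proof (cases rule: is_sym_gen_cases)
  case xy then show ?thesis by (intro that(1)) (simp_all add: pABC_defs algebra_simps)
next
  case yz then show ?thesis by (intro that(2)) (simp_all add: pABC_defs algebra_simps)
next
  case zw then show ?thesis by (intro that(3)) (simp_all add: pABC_defs algebra_simps)
next
  case (scale u)
  have "const4 u ^ 4 = 1" using const4_power[of u 4] by (simp add: scale(1) del: const4_power)
  with scale show ?thesis by (intro that(4)) (simp_all add: pABC_defs power_mult_distrib)
qed

definition sym_closed :: "R4 set \<Rightarrow> bool" where
  "sym_closed S \<longleftrightarrow> (\<forall>h f. is_sym_gen h \<longrightarrow> f \<in> S \<longrightarrow> h f \<in> S)"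

lemma sym_closedD:
  assumes "sym_closed S" "f \<in> S"
  shows "subst4 vary varx varz varw f \<in> S" "subst4 varx varz vary varw f \<in> S"
    "subst4 varx vary varw varz f \<in> S"
    "u ^ 4 = 1 \<Longrightarrow> subst4 varx (const4 u * vary) varz varw f \<in> S"
  using assms unfolding sym_closed_def is_sym_gen_def by blast+

lemma sym_closed_I4: "sym_closed I4"
  unfolding sym_closed_def
proof (intro allI impI)
  fix h f assume h: "is_sym_gen h" and "f \<in> I4"
  have "is_ideal (h -` I4)"
    by (auto simp: is_ideal_def is_sym_gen_hom[OF h] intro: is_idealD[OF is_ideal_I4])
  moreover have "h pA * (h varx * h vary) \<in> I4 \<and> h pA * (h varz * h varw) \<in> I4 \<and>
        h pB * (h varx * h varz) \<in> I4 \<and> h pB * (h vary * h varw) \<in> I4 \<and>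
        h pC * (h varx * h varw) \<in> I4 \<and> h pC * (h vary * h varz) \<in> I4"
    using h
  proof (cases rule: is_sym_gen_pABC)
    case (scale u)
    then show ?thesis
      using I4_multiples[of "const4 u"] I4_gens by (simp add: mult_ac)
  qed (use is_idealD(5)[OF is_ideal_I4 I4_gens(1)] is_idealD(5)[OF is_ideal_I4 I4_gens(2)]
    is_idealD(5)[OF is_ideal_I4 I4_gens(5)] is_idealD(5)[OF is_ideal_I4 I4_gens(6)]
    I4_gens in \<open>simp_all add: mult_ac\<close>)
  ultimately have "I4 \<subseteq> h -` I4"
    by (intro I4_subset) (simp_all add: is_sym_gen_hom[OF h])
  then show "h f \<in> I4" using \<open>f \<in> I4\<close> by auto
qed

lemma sym_gen_ideal_pow:
  assumes "is_sym_gen h" "sym_closed I" "f \<in> ideal_pow I n"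
  shows "h f \<in> ideal_pow I n"
proof -
  have "ideal_pow I n \<subseteq> h -` ideal_pow I n"
  proof (rule ideal_pow_subset[of "\<lambda>n. h -` ideal_pow I n"])
    show "is_ideal (h -` ideal_pow I n)" for n
      by (auto simp: is_ideal_def is_sym_gen_hom[OF assms(1)] intro: is_idealD[OF is_ideal_pow])
    show "a * b \<in> h -` ideal_pow I (Suc n)" if "a \<in> I" "b \<in> h -` ideal_pow I n" for a b n
      using that assms(1,2) mult_in_ideal_pow_Suc
      unfolding vimage_def mem_Collect_eq is_sym_gen_hom[OF assms(1)] sym_closed_def by blast
  qed simp
  then show ?thesis using assms by auto
qed

text \<open>A symmetry is an automorphism preserving \<open>I\<close>, so it permutes the associated
  primes: the preimage of \<open>I : q\<close> is the colon ideal of \<open>I\<close> by the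
  preimage of \<open>q\<close>.\<close>

lemma sym_closed_symbolic_power:
  assumes I: "sym_closed I"
  shows "sym_closed (symbolic_power I m)"
  unfolding sym_closed_def symbolic_power_def
proof (intro allI impI INT_I)
  fix h f P assume h: "is_sym_gen h" and f: "f \<in> (\<Inter>P\<in>associated_primes I. loc_contract (ideal_pow I m) P)"
    and "P \<in> associated_primes I"
  then obtain q where P: "prime_ideal P" "P = ideal_colon I q"
    unfolding associated_primes_def by blast
  note hom = is_sym_gen_hom[OF h]
  obtain h' where h': "is_sym_gen h'" "\<And>f. h (h' f) = f" "\<And>f. h' (h f) = f"
    using h by (rule is_sym_gen_inverse) blast
  have "h -` P = ideal_colon I (h' q)"
  proof -
    have "h r * q \<in> I \<longleftrightarrow> r * h' q \<in> I" for r
    proof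
      assume "h r * q \<in> I"
      then have "h' (h r * q) \<in> I" using I h'(1) unfolding sym_closed_def by blast
      then show "r * h' q \<in> I" by (simp add: is_sym_gen_hom[OF h'(1)] h')
    next
      assume "r * h' q \<in> I"
      then have "h (r * h' q) \<in> I" using I h unfolding sym_closed_def by blast
      then show "h r * q \<in> I" by (simp add: hom h')
    qed
    then show ?thesis by (auto simp: P ideal_colon_def)
  qed
  moreover have "prime_ideal (h -` P)"
  proof -
    have "h -` P \<noteq> UNIV"
    proof
      assume "h -` P = UNIV"
      then have "h (h' r) \<in> P" for r by blast
      then show False using P(1) by (auto simp: prime_ideal_def h')
    qed
    then show ?thesis
      using P(1) by (auto simp: prime_ideal_def is_ideal_def hom)
  qed
  ultimately have "h -` P \<in> associated_primes I"
    unfolding associated_primes_def by blast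
  then obtain s where s: "h s \<notin> P" "s * f \<in> ideal_pow I m"
    using f unfolding loc_contract_def by blast
  then have "h s * h f \<in> ideal_pow I m"
    using sym_gen_ideal_pow[OF h I s(2)] by (simp add: hom)
  then show "h f \<in> loc_contract (ideal_pow I m) P"
    using s unfolding loc_contract_def by blast
qed

subsection \<open>The lower bound\<close>

text \<open>Homogeneity becomes the eigenvalue equation \<open>scale2 f = 2 ^ d * f\<close>, which can be divided by a
  homogeneous factor.\<close>

abbreviation scale2 :: "R4 \<Rightarrow> R4" where
  "scale2 \<equiv> subst4 (2 * varx) (2 * vary) (2 * varz) (2 * varw)"

lemma lookup_const4_mult [simp]: "Poly_Mapping.lookup (const4 c * f) e = c * Poly_Mapping.lookup f e"
proof (induction f rule: R4_monom_induct)
  case (monom e' u)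
  have "const4 c * (const4 u * monom4 e') = Poly_Mapping.single e' (c * u)"
    by (simp add: single_conv_monom4)
  then show ?case
    by (simp add: lookup_single when_def single_conv_monom4 [symmetric])
qed (simp add: lookup_add algebra_simps)

lemma lookup_scale2: "Poly_Mapping.lookup (scale2 f) e = 2 ^ mdeg e * Poly_Mapping.lookup f e"
proof (induction f rule: R4_monom_induct)
  case (monom e' c)
  obtain i j k l where e': "e' = (i, j, k, l)" by (cases e')
  have "scale2 (const4 c * monom4 e') = const4 (2 ^ mdeg e') * (const4 c * monom4 e')"
    by (simp only: e' subst4_monom)
       (simp add: power_mult_distrib power_add monom4_conv_var mdeg_def mult_ac)
  then show ?case
    by (auto simp: lookup_single when_def single_conv_monom4 [symmetric] simp del: const4_power)
qed (simp add: lookup_add algebra_simps)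

text \<open>Coefficients are compared one by one; the powers of 2 are pairwise distinct, so the
  eigenvalue determines the degree.\<close>

lemma homogeneous_iff_scale2:
  "homogeneous_of_degree f d \<longleftrightarrow> scale2 f = 2 ^ d * f"
proof -
  have "scale2 f = 2 ^ d * f \<longleftrightarrow>
      (\<forall>e. 2 ^ mdeg e * Poly_Mapping.lookup f e = 2 ^ d * Poly_Mapping.lookup f e)"
    using lookup_const4_mult[of "2 ^ d" f]
    by (auto simp: poly_mapping_eq_iff fun_eq_iff lookup_scale2)
  also have "\<dots> \<longleftrightarrow> (\<forall>e. Poly_Mapping.lookup f e \<noteq> 0 \<longrightarrow> mdeg e = d)"
  proof -
    have "(2::complex) ^ i = 2 ^ j \<longleftrightarrow> i = j" for i j
    proof -
      have "(2::complex) ^ i = 2 ^ j \<longleftrightarrow> of_nat (2 ^ i) = (of_nat (2 ^ j) :: complex)" by simp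
      then show ?thesis by (simp only: of_nat_eq_iff) simp
    qed
    then show ?thesis by (simp only: mult_cancel_right) blast
  qed
  finally show ?thesis
    by (simp only: homogeneous_of_degree_def Ball_def in_keys_iff)
qed

text \<open>Every monomial of \<open>f\<close> is a monomial of \<open>g\<close> times one of the
  cofactor, and degrees add.\<close>

lemma homogeneous_dvd_imp_le:
  assumes "homogeneous_of_degree f d" "homogeneous_of_degree g e" "g dvd f" "f \<noteq> 0"
  shows "e \<le> d"
proof -
  obtain h where h: "f = g * h" using assms(3) by (elim dvdE)
  obtain t where t: "t \<in> Poly_Mapping.keys f"
    using assms(4) by (metis keys_eq_empty all_not_in_conv)
  then obtain a b where ab: "t = a + b" "a \<in> Poly_Mapping.keys g"
    using keys_mult[of g h] h by blast
  have "mdeg t = mdeg a + mdeg b"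
    unfolding ab by (cases a; cases b) (simp add: mdeg_def)
  moreover have "mdeg t = d" "mdeg a = e"
    using assms(1,2) t ab(2) unfolding homogeneous_of_degree_def by blast+
  ultimately show ?thesis by simp
qed

lemma homogeneous_mult_cancel:
  assumes "homogeneous_of_degree (g * h) d" "homogeneous_of_degree g e" "g * h \<noteq> 0"
  shows "homogeneous_of_degree h (d - e)"
proof -
  have "e \<le> d" using homogeneous_dvd_imp_le[OF assms(1,2) _ assms(3)] by simp
  then have "(2::R4) ^ d = 2 ^ e * 2 ^ (d - e)" by (simp add: power_add [symmetric])
  then have "2 ^ e * g * scale2 h = 2 ^ e * g * (2 ^ (d - e) * h)"
    using assms(1,2) unfolding homogeneous_iff_scale2 by (simp add: mult_ac)
  then show ?thesis using assms(3) by (simp add: homogeneous_iff_scale2)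
qed

lemma homogeneous_mult:
  "homogeneous_of_degree f d \<Longrightarrow> homogeneous_of_degree g e \<Longrightarrow> homogeneous_of_degree (f * g) (d + e)"
  by (simp add: homogeneous_iff_scale2 power_add mult_ac)

lemma homogeneous_power:
  "homogeneous_of_degree f d \<Longrightarrow> homogeneous_of_degree (f ^ n) (d * n)"
  by (simp add: homogeneous_iff_scale2 power_mult power_mult_distrib)

lemma homogeneous_pABC:
  "homogeneous_of_degree pA 8" "homogeneous_of_degree pB 8" "homogeneous_of_degree pC 8"
  by (simp_all add: homogeneous_iff_scale2 pABC_defs power_mult_distrib algebra_simps)

lemma subst4_nonzero: "subst4 a b c d f \<noteq> 0 \<Longrightarrow> f \<noteq> 0"
  by auto

lemma var4_diff_nonzero:
  "varx ^ 4 - vary ^ 4 \<noteq> 0" "varx ^ 4 - varz ^ 4 \<noteq> 0" "varx ^ 4 - varw ^ 4 \<noteq> 0"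
  "vary ^ 4 - varz ^ 4 \<noteq> 0" "vary ^ 4 - varw ^ 4 \<noteq> 0" "varz ^ 4 - varw ^ 4 \<noteq> 0"
  \<comment> \<open>At the point (1, 2, 3, 4) the fourth powers of the coordinates are pairwise
    distinct.\<close>
  by (rule subst4_nonzero[of 1 2 3 4], simp)+

lemma var4_neq [simp]:
  "varx ^ 4 \<noteq> vary ^ 4" "varx ^ 4 \<noteq> varz ^ 4" "varx ^ 4 \<noteq> varw ^ 4"
  "vary ^ 4 \<noteq> varz ^ 4" "vary ^ 4 \<noteq> varw ^ 4" "varz ^ 4 \<noteq> varw ^ 4"
  "vary ^ 4 \<noteq> varx ^ 4" "varz ^ 4 \<noteq> varx ^ 4" "varw ^ 4 \<noteq> varx ^ 4"
  "varz ^ 4 \<noteq> vary ^ 4" "varw ^ 4 \<noteq> vary ^ 4" "varw ^ 4 \<noteq> varz ^ 4"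
  using var4_diff_nonzero by auto

lemma var_neq_0 [simp]: "varx \<noteq> 0" "vary \<noteq> 0" "varz \<noteq> 0" "varw \<noteq> 0"
  by (rule subst4_nonzero[of 1 1 1 1], simp)+

lemma pABC_nonzero: "pA \<noteq> 0" "pB \<noteq> 0" "pC \<noteq> 0"
  using var4_diff_nonzero by (simp_all add: pABC_defs)

section \<open>Differences of fourth powers as products of linear forms\<close>

lemma prime_power_mult_dvd:
  fixes l :: "'a::idom"
  assumes "prime_elem l" "\<not> l dvd q" "l ^ m dvd f" "q dvd f"
  shows "l ^ m * q dvd f"
  using prod_list_mult_dvd[of "replicate m l" q f] assms by simp

text \<open>The coefficients run through the fourth roots of unity. Keeping \<open>const4 1\<close>
  and \<open>const4 (- 1)\<close> unsimplified gives all four factors the same shape.\<close>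

lemma quartic_factorization:
  "a ^ 4 - b ^ 4 = (const4 1 * b - a) * ((const4 (- 1) * b - a) *
     ((const4 \<i> * b - a) * (const4 (- \<i>) * b - a)))"
proof -
  have i: "const4 \<i> * const4 \<i> = - 1"
    using const4_simps(4)[of \<i> \<i>] by (simp del: const4_simps(4))
  have "(const4 \<i> * b - a) * (const4 (- \<i>) * b - a) = a ^ 2 - (const4 \<i> * const4 \<i>) * b ^ 2"
    by (simp add: algebra_simps power2_eq_square)
  then have *: "(const4 \<i> * b - a) * (const4 (- \<i>) * b - a) = a ^ 2 + b ^ 2"
    unfolding i by simp
  show ?thesis
    unfolding * by (simp add: algebra_simps eval_nat_numeral)
qed

lemma roots4: "(1::complex) ^ 4 = 1" "(- 1 :: complex) ^ 4 = 1" "\<i> ^ 4 = 1" "(- \<i>) ^ 4 = 1"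
  by (simp_all add: eval_nat_numeral)

text \<open>The four linear factors are primes, none dividing another, so their separate
  \<open>m\<close>-th powers can be multiplied together.\<close>

lemma quartic_power_dvd:
  assumes "\<And>v. v ^ 4 = 1 \<Longrightarrow> prime_elem (const4 v * b - a)"
    and "\<And>v v'. v \<noteq> v' \<Longrightarrow> v ^ 4 = 1 \<Longrightarrow> v' ^ 4 = 1 \<Longrightarrow> \<not> const4 v * b - a dvd const4 v' * b - a"
    and "\<And>v. v ^ 4 = 1 \<Longrightarrow> (const4 v * b - a) ^ m dvd f"
  shows "(a ^ 4 - b ^ 4) ^ m dvd f"
  unfolding quartic_factorization power_mult_distrib
  by (intro prime_power_mult_dvd assms(1,3) roots4)
     (auto simp: prime_elem_dvd_mult_iff[OF assms(1)] roots4 assms(2) complex_eq_iff simp del: const4_simps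
       dest!: prime_elem_dvd_power[OF assms(1), rotated])

text \<open>Presents the power as a list of linear forms, the shape that the cancellation results
  for lists of primes expect.\<close>

lemma quartic_power_prod_list:
  obtains ls where "prod_list ls = (a ^ 4 - b ^ 4) ^ m"
    and "\<And>l. l \<in> set ls \<Longrightarrow> \<exists>v. v ^ 4 = 1 \<and> l = const4 v * b - a"
proof -
  define qs where "qs = [const4 1 * b - a, const4 (- 1) * b - a, const4 \<i> * b - a, const4 (- \<i>) * b - a]"
  let ?ls = "concat (replicate m qs)"
  have "prod_list ?ls = (a ^ 4 - b ^ 4) ^ m"
    unfolding quartic_factorization
    by (induction m) (auto simp: qs_def mult.assoc simp del: const4_simps)
  moreover have "\<exists>v. v ^ 4 = 1 \<and> l = const4 v * b - a" if "l \<in> set ?ls" for l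
  proof -
    from that have "l \<in> set qs" by (auto simp: set_replicate_conv_if split: if_splits)
    then consider "l = const4 1 * b - a" | "l = const4 (- 1) * b - a"
      | "l = const4 \<i> * b - a" | "l = const4 (- \<i>) * b - a"
      by (auto simp: qs_def simp del: const4_simps)
    then show ?thesis by cases (use roots4 in blast)+
  qed
  ultimately show ?thesis by (rule that)
qed

lemma quartic_mult_dvd:
  assumes "\<And>v. v ^ 4 = 1 \<Longrightarrow> prime_elem (const4 v * b - a)"
    and "\<And>v. v ^ 4 = 1 \<Longrightarrow> \<not> const4 v * b - a dvd q"
    and "(a ^ 4 - b ^ 4) ^ m dvd f" "q dvd f"
  shows "(a ^ 4 - b ^ 4) ^ m * q dvd f"
  by (rule quartic_power_prod_list[of a b m]) (metis prod_list_mult_dvd assms)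

lemma quartic_dvd_cancel:
  assumes "\<And>v. v ^ 4 = 1 \<Longrightarrow> prime_elem (const4 v * b - a)"
    and "\<And>v. v ^ 4 = 1 \<Longrightarrow> \<not> const4 v * b - a dvd q"
    and "a ^ 4 - b ^ 4 dvd p * q"
  shows "a ^ 4 - b ^ 4 dvd p"
  by (rule quartic_power_prod_list[of a b 1]) (metis prod_list_dvd_cancel assms power_one_right)

lemma diff_dvd_diff_swap: "a - b dvd b - (a :: 'a :: comm_ring_1)"
  by (metis dvd_minus_iff dvd_refl minus_diff_eq)

lemma lin_x_dvd_iff:
  assumes "b \<in> {vary, varz, varw}"
  shows "const4 v * b - varx dvd f \<longleftrightarrow> subst4 (const4 v * b) vary varz varw f = 0"
proof (rule dvd_iff_subst4_eq_0)
  show "const4 v * b - varx dvd varx - const4 v * b" by (rule diff_dvd_diff_swap)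
qed (use assms in auto)

lemma lin_y_dvd_iff:
  assumes "b \<in> {varz, varw}"
  shows "const4 v * b - vary dvd f \<longleftrightarrow> subst4 varx (const4 v * b) varz varw f = 0"
proof (rule dvd_iff_subst4_eq_0)
  show "const4 v * b - vary dvd vary - const4 v * b" by (rule diff_dvd_diff_swap)
qed (use assms in auto)

lemma prime_elem_lin_x:
  assumes "b \<in> {vary, varz, varw}"
  shows "prime_elem (const4 v * b - varx)"
proof (rule prime_elem_subst4[of _ "const4 v * b" vary varz varw])
  show "const4 v * b - varx dvd varx - const4 v * b" by (rule diff_dvd_diff_swap)
  show "const4 v * b - varx \<noteq> 0"
    by (rule subst4_nonzero[of 1 0 0 0]) (use assms in auto)
qed (use assms in auto)

lemma prime_elem_lin_y:
  assumes "b \<in> {varz, varw}"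
  shows "prime_elem (const4 v * b - vary)"
proof (rule prime_elem_subst4[of _ varx "const4 v * b" varz varw])
  show "const4 v * b - vary dvd vary - const4 v * b" by (rule diff_dvd_diff_swap)
  show "const4 v * b - vary \<noteq> 0"
    by (rule subst4_nonzero[of 0 1 0 0]) (use assms in auto)
qed (use assms in auto)

lemma const4_root [simp]: "v ^ 4 = 1 \<Longrightarrow> (const4 v * f) ^ 4 = f ^ 4"
  using const4_power[of v 4] by (simp add: power_mult_distrib del: const4_power)

lemma quartic_x_power_dvd:
  assumes b: "b \<in> {vary, varz, varw}"
    and "\<And>v. v ^ 4 = 1 \<Longrightarrow> (const4 v * b - varx) ^ m dvd f"
  shows "(varx ^ 4 - b ^ 4) ^ m dvd f"
proof (rule quartic_power_dvd)
  fix v v' :: complex assume "v \<noteq> v'"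
  moreover have "b \<noteq> 0" "subst4 (const4 v * b) vary varz varw b = b" using b by auto
  ultimately show "\<not> const4 v * b - varx dvd const4 v' * b - varx"
    using b by (subst lin_x_dvd_iff) auto
qed (use assms prime_elem_lin_x[OF b] in auto)

text \<open>The product of the linear forms of all 24 planes in the orbit of \<open>x = y\<close>;
  this is the factor removed in the descent.\<close>

definition pABC :: R4 where "pABC = pA * pB * pC"

lemma pABC_dvd:
  assumes "varx ^ 4 - vary ^ 4 dvd f" "varx ^ 4 - varz ^ 4 dvd f" "varx ^ 4 - varw ^ 4 dvd f"
    "vary ^ 4 - varz ^ 4 dvd f" "vary ^ 4 - varw ^ 4 dvd f" "varz ^ 4 - varw ^ 4 dvd f"
  shows "pABC dvd f"
proof -
  \<comment> \<open>The six quartics are adjoined one by one, those in y before those in x. The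
    linear factors of a new quartic miss the earlier ones, as substituting for y or x shows.\<close>
  let ?q1 = "(vary ^ 4 - varw ^ 4) ^ 1 * (varz ^ 4 - varw ^ 4)"
  have q1: "?q1 dvd f"
    by (rule quartic_mult_dvd[OF prime_elem_lin_y]) (use assms in \<open>auto simp: lin_y_dvd_iff\<close>)
  let ?q2 = "(vary ^ 4 - varz ^ 4) ^ 1 * ?q1"
  have q2: "?q2 dvd f"
    by (rule quartic_mult_dvd[OF prime_elem_lin_y _ _ q1]) (use assms in \<open>auto simp: lin_y_dvd_iff\<close>)
  let ?q3 = "(varx ^ 4 - varw ^ 4) ^ 1 * ?q2"
  have q3: "?q3 dvd f"
    by (rule quartic_mult_dvd[OF prime_elem_lin_x _ _ q2]) (use assms in \<open>auto simp: lin_x_dvd_iff\<close>)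
  let ?q4 = "(varx ^ 4 - varz ^ 4) ^ 1 * ?q3"
  have q4: "?q4 dvd f"
    by (rule quartic_mult_dvd[OF prime_elem_lin_x _ _ q3]) (use assms in \<open>auto simp: lin_x_dvd_iff\<close>)
  let ?q5 = "(varx ^ 4 - vary ^ 4) ^ 1 * ?q4"
  have q5: "?q5 dvd f"
    by (rule quartic_mult_dvd[OF prime_elem_lin_x _ _ q4]) (use assms in \<open>auto simp: lin_x_dvd_iff\<close>)
  have "?q5 = pABC" by (simp add: pABC_def pABC_defs mult_ac)
  with q5 show ?thesis by simp
qed

text \<open>A chart of the blow-up of the line \<open>x = y = z\<close>, in which \<open>z = 0\<close> is the exceptional divisor.\<close>

abbreviation blowup :: "R4 \<Rightarrow> R4" where
  "blowup \<equiv> subst4 varx (varx + varz * vary) (varx + varz) varw"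

lemma varz_dvd_iff: "varz dvd f \<longleftrightarrow> subst4 varx vary 0 varw f = 0"
  by (rule dvd_iff_subst4_eq_0) auto

lemma prime_elem_varz: "prime_elem varz"
  by (rule prime_elem_subst4[of _ varx vary 0 varw]) auto

text \<open>The exceptional divisor maps onto the line \<open>x = y = z\<close>, so the pullback
  vanishes on it exactly when \<open>f\<close> vanishes on that line.\<close>

lemma varz_dvd_blowup_iff: "varz dvd blowup f \<longleftrightarrow> subst4 varx varx varx varw f = 0"
  by (simp add: varz_dvd_iff subst4_subst4)

lemma varz_power_dvd_cancel: "\<not> varz dvd q \<Longrightarrow> varz ^ m dvd p * q \<Longrightarrow> varz ^ m dvd p"
  using prod_list_dvd_cancel[of "replicate m varz" q p] prime_elem_varz by simp

text \<open>Of the six quartics only the three among x, y, z vanish on the line, and each does so to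
  first order.\<close>

lemma blowup_pABC:
  obtains U where "blowup pABC = varz ^ 3 * U" "\<not> varz dvd U"
proof -
  \<comment> \<open>\<open>U1\<close>, \<open>U2\<close>, \<open>U3\<close> are the differences of
    the fourth powers of x, x + zy and x + z, divided by z; \<open>V\<close> collects the factors
    involving w.\<close>
  define U1 where "U1 = - (4*varx^3*vary + 6*varx^2*vary^2*varz + 4*varx*vary^3*varz^2 + vary^4*varz^3)"
  define U2 where "U2 = - (4*varx^3 + 6*varx^2*varz + 4*varx*varz^2 + varz^3)"
  define U3 where "U3 = 4*varx^3*(vary - 1) + 6*varx^2*varz*(vary^2 - 1) + 4*varx*varz^2*(vary^3 - 1)
    + varz^3*(vary^4 - 1)"
  define V where "V = ((varx + varz)^4 - varw^4) * ((varx + varz * vary)^4 - varw^4) * (varx^4 - varw^4)"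
  have 1: "varx^4 - (varx + varz * vary)^4 = varz * U1"
    unfolding U1_def by (simp add: algebra_simps eval_nat_numeral)
  have 2: "varx^4 - (varx + varz)^4 = varz * U2"
    unfolding U2_def by (simp add: algebra_simps eval_nat_numeral)
  have 3: "(varx + varz * vary)^4 - (varx + varz)^4 = varz * U3"
    unfolding U3_def by (simp add: algebra_simps eval_nat_numeral)
  have "blowup pABC = (varz * U1) * (varz * U2) * (varz * U3) * V"
    unfolding 1[symmetric] 2[symmetric] 3[symmetric] V_def
    by (simp add: pABC_def pABC_defs mult_ac)
  then have "blowup pABC = varz ^ 3 * (U1 * U2 * U3 * V)"
    by (simp add: eval_nat_numeral mult_ac)
  \<comment> \<open>At z = 0 the factor \<open>U3\<close> becomes 4x^3(y - 1).\<close>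
  moreover have "vary - 1 \<noteq> 0"
    by (rule subst4_nonzero[of 0 0 0 0]) simp
  then have "\<not> varz dvd U1 * U2 * U3 * V"
    by (simp add: varz_dvd_iff U1_def U2_def U3_def V_def)
  ultimately show ?thesis by (rule that)
qed

lemma sym_gen_homogeneous:
  assumes "is_sym_gen h" "homogeneous_of_degree f d"
  shows "homogeneous_of_degree (h f) d"
proof -
  have "scale2 (h f) = h (scale2 f)"
    using assms(1) by (cases rule: is_sym_gen_cases) (simp_all add: subst4_subst4 mult_ac)
  moreover have "h (2 ^ d * f) = 2 ^ d * h f"
    using assms(1) by (cases rule: is_sym_gen_cases) simp_all
  ultimately show ?thesis
    using assms(2) by (simp add: homogeneous_iff_scale2)
qed

text \<open>The plane \<open>x = y\<close> contains eight lines of the orbit of \<open>x = y = z\<close>, so the restriction of \<open>f\<close>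
  is divisible by the \<open>m\<close>-th powers of eight distinct linear forms.\<close>

lemma restrict_plane_eq_0:
  assumes S: "sym_closed S" "\<And>f. f \<in> S \<Longrightarrow> varz ^ m dvd blowup f"
    and f: "f \<in> S" "homogeneous_of_degree f d" and "d < 8 * m"
  shows "subst4 varx varx varz varw f = 0"
proof (rule ccontr)
  let ?r = "\<lambda>f. subst4 varx varx varz varw f"
  assume "?r f \<noteq> 0"
  have z: "(const4 v * varz - varx) ^ m dvd ?r f" if "f \<in> S" "v ^ 4 = 1" for f v
  proof -
    have "(v ^ 3) ^ 4 = (v ^ 4) ^ 3" by (simp add: power_mult [symmetric])
    \<comment> \<open>Here \<open>v ^ 3\<close> is the inverse of \<open>v\<close>. Conjugating the
      scaling of y by the swap of y and z produces the scaling of z.\<close>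
    then have "subst4 varx (const4 (v ^ 3) * vary) varz varw (subst4 varx varz vary varw f) \<in> S"
      using that by (intro sym_closedD(4)[OF S(1)] sym_closedD(2)[OF S(1)]) simp_all
    then have "subst4 varx vary (const4 (v ^ 3) * varz) varw f \<in> S"
      using sym_closedD(2)[OF S(1)] by (fastforce simp: subst4_subst4)
    then have "varz ^ m dvd blowup (subst4 varx vary (const4 (v ^ 3) * varz) varw f)"
      by (rule S(2))
    \<comment> \<open>Setting y to 0 and z to vz - x in the chart gives the point (x, x, vz, w). The
      two scalings of z cancel and leave the restriction of \<open>f\<close>, while the exceptional
      divisor becomes vz - x.\<close>
    then have "subst4 varx 0 (const4 v * varz - varx) varw (varz ^ m) dvd
        subst4 varx 0 (const4 v * varz - varx) varw
          (blowup (subst4 varx vary (const4 (v ^ 3) * varz) varw f))"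
      by (metis dvd_def subst4_mult)
    moreover have "const4 v ^ 3 * (const4 v * varz) = const4 (v ^ 4) * varz"
      by (simp add: eval_nat_numeral mult_ac)
    ultimately show ?thesis
      using that(2) by (simp add: subst4_subst4)
  qed
  have w: "(const4 v * varw - varx) ^ m dvd ?r f" if "v ^ 4 = 1" for v
  proof -
    \<comment> \<open>The lines with w in place of z follow by applying the previous claim to
      \<open>f\<close> with z and w swapped.\<close>
    have "(const4 v * varz - varx) ^ m dvd ?r (subst4 varx vary varw varz f)"
      using that f(1) by (intro z sym_closedD(3)[OF S(1)])
    then have "subst4 varx vary varw varz ((const4 v * varz - varx) ^ m) dvd
        subst4 varx vary varw varz (?r (subst4 varx vary varw varz f))"
      by (metis dvd_def subst4_mult)
    then show ?thesis by (simp add: subst4_subst4)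
  qed
  have "(varx ^ 4 - varw ^ 4) ^ m dvd ?r f"
    using w by (intro quartic_x_power_dvd) auto
  moreover have "(varx ^ 4 - varz ^ 4) ^ m dvd ?r f"
    using z[OF f(1)] by (intro quartic_x_power_dvd) auto
  ultimately have "(varx ^ 4 - varz ^ 4) ^ m * (varx ^ 4 - varw ^ 4) ^ m dvd ?r f"
    by (intro quartic_mult_dvd prime_elem_lin_x) (auto simp: lin_x_dvd_iff)
  moreover have "homogeneous_of_degree ((varx ^ 4 - varz ^ 4) ^ m * (varx ^ 4 - varw ^ 4) ^ m) (4 * m + 4 * m)"
    by (intro homogeneous_mult homogeneous_power)
       (simp_all add: homogeneous_iff_scale2 power_mult_distrib algebra_simps)
  moreover have "homogeneous_of_degree (?r f) d"
  proof -
    have "scale2 (?r f) = ?r (scale2 f)" by (simp add: subst4_subst4)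
    then show ?thesis using f(2) by (simp add: homogeneous_iff_scale2)
  qed
  ultimately have "4 * m + 4 * m \<le> d"
    using homogeneous_dvd_imp_le \<open>?r f \<noteq> 0\<close> by blast
  then show False using \<open>d < 8 * m\<close> by simp
qed

text \<open>Vanishing on x = y spreads by scaling to the four planes of
  \<open>varx ^ 4 - vary ^ 4\<close>, and transpositions carry this quartic to the other
  five.\<close>

lemma sym_closed_pABC_dvd:
  assumes S: "sym_closed S" and r: "\<And>f. f \<in> S \<Longrightarrow> subst4 varx varx varz varw f = 0" and "f \<in> S"
  shows "pABC dvd f"
proof -
  note swap = sym_closedD(1-3)[OF S]
  have tr: "subst4 a b c d g dvd f"
    if "g dvd subst4 p q r s f" "subst4 a b c d (subst4 p q r s f) = f" for g f a b c d p q r s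
    using that by (metis dvd_def subst4_mult)
  have xy: "varx ^ 4 - vary ^ 4 dvd f" if f: "f \<in> S" for f
  proof -
    have "const4 v * vary - varx dvd f" if v: "v ^ 4 = 1" for v
    proof -
      have "(v ^ 3) ^ 4 = (v ^ 4) ^ 3" by (simp add: power_mult [symmetric])
      then have "subst4 varx (const4 (v ^ 3) * vary) varz varw f \<in> S"
        using f v by (intro sym_closedD(4)[OF S]) simp_all
      then have "subst4 (const4 v * vary) vary varz varw (subst4 varx varx varz varw
          (subst4 varx (const4 (v ^ 3) * vary) varz varw f)) = 0"
        by (subst r) simp_all
      moreover have "const4 v ^ 3 * (const4 v * vary) = const4 (v ^ 4) * vary"
        by (simp add: eval_nat_numeral mult_ac)
      ultimately have "subst4 (const4 v * vary) vary varz varw f = 0"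
        using v by (simp add: subst4_subst4)
      then show ?thesis by (simp add: lin_x_dvd_iff)
    qed
    then show ?thesis using quartic_x_power_dvd[of vary 1 f] by simp
  qed
  have xz: "varx ^ 4 - varz ^ 4 dvd f" if "f \<in> S" for f
    using tr[OF xy[OF swap(2)[OF that]], of varx varz vary varw] by (simp add: subst4_subst4)
  have xw: "varx ^ 4 - varw ^ 4 dvd f" if "f \<in> S" for f
    using tr[OF xz[OF swap(3)[OF that]], of varx vary varw varz] by (simp add: subst4_subst4)
  have yz: "vary ^ 4 - varz ^ 4 dvd f" if "f \<in> S" for f
    using tr[OF xz[OF swap(1)[OF that]], of vary varx varz varw] by (simp add: subst4_subst4)
  have yw: "vary ^ 4 - varw ^ 4 dvd f" if "f \<in> S" for f
    using tr[OF xw[OF swap(1)[OF that]], of vary varx varz varw] by (simp add: subst4_subst4)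
  have zw: "varz ^ 4 - varw ^ 4 dvd f" if "f \<in> S" for f
    using tr[OF yw[OF swap(2)[OF that]], of varx varz vary varw] by (simp add: subst4_subst4)
  show ?thesis
    using xy xz xw yz yw zw \<open>f \<in> S\<close> by (intro pABC_dvd)
qed

text \<open>The symmetric set \<open>S\<close> is arbitrary so that the induction can pass to the
  set of quotients by \<open>pABC\<close>.\<close>

lemma degree_lower_bound:
  assumes "sym_closed S" "\<And>f. f \<in> S \<Longrightarrow> varz ^ m dvd blowup f"
    and "f \<in> S" "f \<noteq> 0" "homogeneous_of_degree f d"
  shows "8 * m \<le> d"
  using assms
proof (induction m arbitrary: S f d rule: less_induct)
  case (less m)
  note S = less.prems(1,2) and f = less.prems(3-5)
  show ?case
  proof (rule ccontr)
    assume "\<not> 8 * m \<le> d"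
    then have d: "d < 8 * m" by simp
    \<comment> \<open>The vanishing on the plane is available only below degree
      \<open>8 * m\<close>, so \<open>S\<close> is cut down to its elements homogeneous of degree
      \<open>d\<close>; symmetries preserve this.\<close>
    let ?T = "{f \<in> S. homogeneous_of_degree f d}"
    have "sym_closed ?T"
      using S(1) sym_gen_homogeneous unfolding sym_closed_def by blast
    then have "pABC dvd f"
    proof (rule sym_closed_pABC_dvd)
      show "subst4 varx varx varz varw f = 0" if "f \<in> ?T" for f
        using restrict_plane_eq_0[OF S _ _ d] that by blast
    qed (use f in simp)
    then obtain g where g: "f = pABC * g" by (elim dvdE)
    have "homogeneous_of_degree (pA * pB * pC) (8 + 8 + 8)"
      by (intro homogeneous_mult homogeneous_pABC)
    then have hom: "homogeneous_of_degree pABC 24" by (simp add: pABC_def)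
    \<comment> \<open>Both signs are allowed because a symmetry may send \<open>pABC\<close> to
      \<open>- pABC\<close>.\<close>
    let ?S' = "{g. pABC * g \<in> S \<or> - (pABC * g) \<in> S}"
    have "sym_closed ?S'"
      unfolding sym_closed_def
    proof (intro allI impI)
      fix h g assume h: "is_sym_gen h" and "g \<in> ?S'"
      then have "h (pABC * g) \<in> S \<or> h (- (pABC * g)) \<in> S"
        using S(1) unfolding sym_closed_def by blast
      moreover have "h pABC = pABC \<or> h pABC = - pABC"
        using h by (cases rule: is_sym_gen_pABC) (auto simp: pABC_def)
      ultimately show "h g \<in> ?S'"
        by (auto simp: is_sym_gen_hom[OF h])
    qed
    moreover have "varz ^ (m - 3) dvd blowup g" if "g \<in> ?S'" for g
    \<comment> \<open>For \<open>m < 3\<close> the truncated exponent \<open>m - 3\<close> is 0 and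
      the divisibility is trivial.\<close>
    proof (cases "m < 3")
      case False
      obtain U where U: "blowup pABC = varz ^ 3 * U" "\<not> varz dvd U" by (rule blowup_pABC)
      have "varz ^ m dvd blowup (pABC * g)"
        using that S(2)[of "pABC * g"] S(2)[of "- (pABC * g)"] by auto
      moreover have "varz ^ m = varz ^ 3 * varz ^ (m - 3)"
        using False by (simp add: power_add [symmetric])
      moreover have "blowup (pABC * g) = varz ^ 3 * (blowup g * U)"
        by (subst subst4_mult, subst U(1)) (simp only: mult_ac)
      ultimately have "varz ^ 3 * varz ^ (m - 3) dvd varz ^ 3 * (blowup g * U)"
        by metis
      then have "varz ^ (m - 3) dvd blowup g * U" by simp
      then show ?thesis using U(2) by (rule varz_power_dvd_cancel[rotated])
    qed simp
    moreover have "m - 3 < m" using d by simp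
    ultimately have "8 * (m - 3) \<le> d - 24"
      using f hom by (intro less.IH[of "m - 3" ?S' g]) (auto simp: g intro: homogeneous_mult_cancel)
    \<comment> \<open>Hence \<open>d - 24\<close> is not truncated; for \<open>m < 3\<close> this
      bound alone contradicts \<open>d < 8 * m\<close>.\<close>
    moreover have "24 \<le> d"
      using homogeneous_dvd_imp_le[OF f(3) hom] g f(2) by simp
    ultimately show False using d by simp
  qed
qed

section \<open>Vanishing of the symbolic powers along the line x = y = z\<close>

text \<open>The ideal of the line is the colon of \<open>I4\<close> by \<open>?g\<close>: the
  cofactors \<open>?g1\<close> and \<open>?g2\<close> turn x - y and x - z into \<open>pA\<close>
  and \<open>pB\<close>, and the variables complete these to generators. Conversely
  \<open>I4\<close> vanishes on the line, whereas \<open>?g\<close> does not.\<close>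

lemma triple_line_associated:
  "{f. subst4 varx varx varx varw f = 0} \<in> associated_primes I4"
proof -
  let ?s = "\<lambda>f. subst4 varx varx varx varw f"
  let ?g1 = "(varx + vary) * (varx^2 + vary^2) * (varz^4 - varw^4)"
  let ?g2 = "(varx + varz) * (varx^2 + varz^2) * (vary^4 - varw^4)"
  let ?g = "?g1 * ?g2 * (varx * vary * varz * varw)"
  have g1: "(varx - vary) * ?g1 = pA" and g2: "(varx - varz) * ?g2 = pB"
    by (simp_all add: pABC_defs algebra_simps eval_nat_numeral)
  have "?s f = 0 \<longleftrightarrow> f * ?g \<in> I4" for f
  proof
    assume f: "?s f = 0"
    \<comment> \<open>Replacing first y and then z by x writes \<open>f\<close> as a combination of
      x - y and x - z.\<close>
    have "varx - vary dvd subst4 varx vary varz varw f - subst4 varx varx varz varw f"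
      by (rule dvd_subst4_diff) (simp_all add: diff_dvd_diff_swap)
    moreover have "varx - varz dvd subst4 varx varx varz varw f - subst4 varx varx varx varw f"
      by (rule dvd_subst4_diff) (simp_all add: diff_dvd_diff_swap)
    ultimately obtain u v where "f - subst4 varx varx varz varw f = (varx - vary) * u"
        "subst4 varx varx varz varw f = (varx - varz) * v"
      using f by (auto elim!: dvdE)
    then have "f = (varx - vary) * u + (varx - varz) * v"
      by (metis diff_add_cancel)
    moreover have "(a * u + b * v) * (p * q * (x * y * z * w)) =
        a * p * (x * y) * (u * q * z * w) + b * q * (x * z) * (v * p * y * w)" for a b p q x y z w :: R4
      by (simp add: algebra_simps)
    ultimately have "f * ?g = (varx - vary) * ?g1 * (varx * vary) * (u * ?g2 * varz * varw) +
        (varx - varz) * ?g2 * (varx * varz) * (v * ?g1 * vary * varw)"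
      by (simp only:)
    then show "f * ?g \<in> I4"
      unfolding g1 g2 by (simp add: is_idealD(2)[OF is_ideal_I4] I4_multiples)
  next
    assume "f * ?g \<in> I4"
    moreover have "I4 \<subseteq> {f. ?s f = 0}"
      by (intro I4_subset) (auto simp: is_ideal_def pABC_defs)
    ultimately have "?s (f * ?g) = 0" by blast
    moreover have "?s ?g \<noteq> 0"
    proof -
      have "varx + varx \<noteq> 0" "varx^2 + varx^2 \<noteq> 0"
        by (rule subst4_nonzero[of 1 1 1 1], simp)+
      then show ?thesis by simp
    qed
    ultimately show "?s f = 0" by simp
  qed
  then have "{f. ?s f = 0} = ideal_colon I4 ?g"
    unfolding ideal_colon_def by blast
  moreover have "prime_ideal {f. ?s f = 0}"
    unfolding prime_ideal_def is_ideal_def by (auto dest: arg_cong[of _ _ "\<lambda>S. 1 \<in> S"])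
  ultimately show ?thesis
    unfolding associated_primes_def by blast
qed

text \<open>Elements of \<open>I4\<close> vanish on the line, so the \<open>m\<close>-th power pulls
  back into multiples of \<open>varz ^ m\<close>. The multiplier \<open>s\<close> does not vanish
  there and can be cancelled.\<close>

lemma symbolic_power_blowup:
  assumes "f \<in> symbolic_power I4 m"
  shows "varz ^ m dvd blowup f"
proof -
  obtain s where s: "subst4 varx varx varx varw s \<noteq> 0" "s * f \<in> ideal_pow I4 m"
    using assms triple_line_associated unfolding symbolic_power_def loc_contract_def by blast
  have "I4 \<subseteq> {f. varz dvd blowup f}"
    unfolding varz_dvd_blowup_iff
    by (intro I4_subset) (auto simp: is_ideal_def pABC_defs)
  then have "ideal_pow I4 m \<subseteq> {f. varz ^ m dvd blowup f}"
    by (intro ideal_pow_subset[of "\<lambda>m. {f. varz ^ m dvd blowup f}"])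
       (auto simp: is_ideal_def intro: mult_dvd_mono)
  then have "varz ^ m dvd blowup f * blowup s"
    using s(2) by (auto simp: mult.commute)
  moreover have "\<not> varz dvd blowup s" using s(1) by (simp add: varz_dvd_blowup_iff)
  ultimately show ?thesis by (rule varz_power_dvd_cancel[rotated])
qed

lemma symbolic_power_I4_degree:
  assumes "f \<in> symbolic_power I4 m" "f \<noteq> 0" "homogeneous_of_degree f d"
  shows "8 * m \<le> d"
  using degree_lower_bound[OF sym_closed_symbolic_power[OF sym_closed_I4] symbolic_power_blowup assms] .

subsection \<open>The upper bound\<close>

definition supported :: "(mon4 \<Rightarrow> bool) \<Rightarrow> R4 set" where
  "supported U = {p. \<forall>e\<in>Poly_Mapping.keys p. U e}"

lemma is_ideal_supported:
  assumes "\<And>e e'. U e \<Longrightarrow> U (e' + e)"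
  shows "is_ideal (supported U)"
  unfolding is_ideal_def
proof (intro conjI ballI allI impI)
  show "p + q \<in> supported U" if "p \<in> supported U" "q \<in> supported U" for p q
    using that keys_add[of p q] unfolding supported_def by blast
  show "r * p \<in> supported U" if "p \<in> supported U" for r p
    using that keys_mult[of r p] assms unfolding supported_def by blast
qed (simp add: supported_def)

lemma monom4_in_supported: "U e \<Longrightarrow> monom4 e \<in> supported U"
  by (auto simp: supported_def monom4_def)

lemma supported_lookup: "p \<in> supported U \<Longrightarrow> \<not> U e \<Longrightarrow> Poly_Mapping.lookup p e = 0"
  by (auto simp: supported_def in_keys_iff)

lemma lookup_monom4_mult: "Poly_Mapping.lookup (monom4 e * p) (e + t) = Poly_Mapping.lookup p t"
proof (induction p rule: R4_monom_induct)
  case (monom e' c)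
  have "monom4 e * (const4 c * monom4 e') = const4 c * monom4 (e + e')"
    by (simp add: monom4_add mult_ac)
  then show ?case
    by (simp add: lookup_single when_def single_conv_monom4 [symmetric] del: lookup_const4_mult)
qed (simp add: algebra_simps lookup_add)

lemma supported_monom4_multD:
  assumes "monom4 e * p \<in> supported U" "t \<in> Poly_Mapping.keys p"
  shows "U (e + t)"
  using supported_lookup[OF assms(1), of "e + t"] assms(2)
  by (auto simp: lookup_monom4_mult in_keys_iff)

text \<open>\<open>J1\<close>, \<open>J2\<close>, \<open>J3\<close> are the exponents of the monomials in the ideals \<open>(xy, zw)\<close>,
  \<open>(xz, yw)\<close>, \<open>(xw, yz)\<close>.\<close>

definition J1 :: "mon4 \<Rightarrow> bool" where "J1 = (\<lambda>(a, b, c, d). a > 0 \<and> b > 0 \<or> c > 0 \<and> d > 0)"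
definition J2 :: "mon4 \<Rightarrow> bool" where "J2 = (\<lambda>(a, b, c, d). a > 0 \<and> c > 0 \<or> b > 0 \<and> d > 0)"
definition J3 :: "mon4 \<Rightarrow> bool" where "J3 = (\<lambda>(a, b, c, d). a > 0 \<and> d > 0 \<or> b > 0 \<and> c > 0)"

lemmas J_defs = J1_def J2_def J3_def

definition J12 :: "R4 set" where "J12 = supported (\<lambda>e. J1 e \<or> J2 e)"
definition J13 :: "R4 set" where "J13 = supported (\<lambda>e. J1 e \<or> J3 e)"
definition J23 :: "R4 set" where "J23 = supported (\<lambda>e. J2 e \<or> J3 e)"

lemmas JJ_defs = J12_def J13_def J23_def

lemma is_ideal_J: "is_ideal J12" "is_ideal J13" "is_ideal J23"
  unfolding JJ_defs by (rule is_ideal_supported; auto simp: J_defs split: prod.splits)+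

lemma var_products:
  "varx * vary = monom4 (1, 1, 0, 0)" "varx * varz = monom4 (1, 0, 1, 0)"
  "varx * varw = monom4 (1, 0, 0, 1)" "vary * varz = monom4 (0, 1, 1, 0)"
  "vary * varw = monom4 (0, 1, 0, 1)" "varz * varw = monom4 (0, 0, 1, 1)"
  by (simp_all add: monom4_conv_var)

lemma J_gens:
  "varx * vary \<in> J12" "varz * varw \<in> J12" "varx * varz \<in> J12" "vary * varw \<in> J12"
  "varx * vary \<in> J13" "varz * varw \<in> J13" "varx * varw \<in> J13" "vary * varz \<in> J13"
  "varx * varz \<in> J23" "vary * varw \<in> J23" "varx * varw \<in> J23" "vary * varz \<in> J23"
  unfolding JJ_defs var_products by (rule monom4_in_supported; simp add: J_defs)+

text \<open>\<open>rep_ok p q\<close> characterises \<open>pB * p + pC * q \<in> I4\<close> by conditions on the monomials of \<open>p\<close> and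
  \<open>q\<close>: in each multidegree \<open>(p, q)\<close> must lie in the span of those of \<open>(1, -1)\<close>, \<open>(1, 0)\<close>, \<open>(0, 1)\<close>
  whose monomial ideal (\<open>J1\<close>, \<open>J2\<close>, \<open>J3\<close> respectively) contains the monomial.\<close>

definition rep_ok :: "R4 \<Rightarrow> R4 \<Rightarrow> bool" where
  "rep_ok p q \<longleftrightarrow> p \<in> J12 \<and> q \<in> J13 \<and> p + q \<in> J23"

lemma rep_ok_add: "rep_ok p q \<Longrightarrow> rep_ok p' q' \<Longrightarrow> rep_ok (p + p') (q + q')"
  using is_idealD(2)[OF is_ideal_J(1), of p p'] is_idealD(2)[OF is_ideal_J(2), of q q']
    is_idealD(2)[OF is_ideal_J(3), of "p + q" "p' + q'"]
  by (simp add: rep_ok_def add_ac)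

lemma rep_ok_mult: "rep_ok p q \<Longrightarrow> rep_ok (r * p) (r * q)"
  using is_idealD(3)[OF is_ideal_J(1), of p r] is_idealD(3)[OF is_ideal_J(2), of q r]
    is_idealD(3)[OF is_ideal_J(3), of "p + q" r]
  by (simp add: rep_ok_def algebra_simps)

text \<open>Each term in the expansion of \<open>pC\<close>, \<open>- pB\<close> and their sum is
  u^4 v^4 with uv a generator of the required ideal. Adding multiples of this pair changes a
  representation without changing the element represented.\<close>

lemma rep_ok_syzygy: "rep_ok pC (- pB)"
proof -
  have quartic: "(u * v) * r = u ^ 4 * v ^ 4" if "r = u ^ 3 * v ^ 3" for u v r :: R4
    using that by (simp add: eval_nat_numeral mult_ac)
  have pow: "u ^ 4 * v ^ 4 \<in> J" if "u * v \<in> J" "is_ideal J" for u v :: R4 and J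
    using is_idealD(4)[OF that(2,1), of "u ^ 3 * v ^ 3"] by (simp add: quartic)
  have C: "pC = varx^4 * vary^4 - varx^4 * varz^4 - vary^4 * varw^4 + varz^4 * varw^4"
    and B: "- pB = varx^4 * varw^4 + vary^4 * varz^4 - varx^4 * vary^4 - varz^4 * varw^4"
    and A: "pC + - pB = varx^4 * varw^4 + vary^4 * varz^4 - varx^4 * varz^4 - vary^4 * varw^4"
    by (simp_all add: pABC_defs algebra_simps)
  show ?thesis
    unfolding rep_ok_def unfolding A unfolding B C
    by (intro conjI is_idealD(2,6) pow J_gens is_ideal_J)
qed

text \<open>\<open>pA = pB - pC\<close> eliminates \<open>pA\<close>: a multiple by \<open>u\<close>
  contributes the pair \<open>(u, - u)\<close>, whose sum is 0.\<close>

lemma I4_rep: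
  assumes "h \<in> I4"
  obtains p q where "rep_ok p q" "h = pB * p + pC * q"
proof -
  let ?J = "{h. \<exists>p q. rep_ok p q \<and> h = pB * p + pC * q}"
  have zero: "rep_ok 0 0"
    using is_ideal_J[THEN is_idealD(1)] by (simp add: rep_ok_def)
  have neg: "- p \<in> J13" if "p \<in> J13" for p
    using is_idealD(5)[OF is_ideal_J(2) that] .
  have "I4 \<subseteq> ?J"
  proof (rule I4_subset)
    show "is_ideal ?J"
      unfolding is_ideal_def
    proof (intro conjI ballI allI impI)
      show "0 \<in> ?J" using zero by force
    next
      fix a b assume "a \<in> ?J" "b \<in> ?J"
      then obtain p q p' q' where "rep_ok p q" "a = pB * p + pC * q" "rep_ok p' q'" "b = pB * p' + pC * q'"
        by blast
      then have "rep_ok (p + p') (q + q')" "a + b = pB * (p + p') + pC * (q + q')"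
        by (simp_all add: rep_ok_add algebra_simps)
      then show "a + b \<in> ?J" by blast
    next
      fix r a assume "a \<in> ?J"
      then obtain p q where "rep_ok p q" "a = pB * p + pC * q"
        by blast
      then have "rep_ok (r * p) (r * q)" "r * a = pB * (r * p) + pC * (r * q)"
        by (auto intro: rep_ok_mult simp: distrib_left mult.left_commute)
      then show "r * a \<in> ?J" by blast
    qed
    have A: "pA * u \<in> ?J" if "u \<in> J12" "u \<in> J13" for u
      using that neg zero
      by (intro CollectI exI[of _ u] exI[of _ "- u"]) (simp add: rep_ok_def pA_eq algebra_simps)
    have B: "pB * u \<in> ?J" if "u \<in> J12" "u \<in> J23" for u
      using that zero by (intro CollectI exI[of _ u] exI[of _ 0]) (simp add: rep_ok_def)
    have C: "pC * u \<in> ?J" if "u \<in> J13" "u \<in> J23" for u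
      using that zero by (intro CollectI exI[of _ 0] exI[of _ u]) (simp add: rep_ok_def)
    show "pA * (varx * vary) \<in> ?J" "pA * (varz * varw) \<in> ?J" "pB * (varx * varz) \<in> ?J"
      "pB * (vary * varw) \<in> ?J" "pC * (varx * varw) \<in> ?J" "pC * (vary * varz) \<in> ?J"
      by (intro A B C J_gens)+
  qed
  then show ?thesis using assms that by blast
qed

text \<open>Membership is checked monomial by monomial. By \<open>pA = pB - pC\<close>, two of the
  three products times a monomial lying in \<open>I4\<close> force the third.\<close>

lemma rep_ok_imp_in_I4:
  assumes "rep_ok p q"
  shows "pB * p + pC * q \<in> I4"
proof -
  let ?u = "Poly_Mapping.lookup p" and ?v = "Poly_Mapping.lookup q"
  let ?K = "Poly_Mapping.keys p \<union> Poly_Mapping.keys q"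
  have p: "p = (\<Sum>e\<in>?K. const4 (?u e) * monom4 e)"
    by (subst R4_sum_monom) (rule sum.mono_neutral_left; auto simp: in_keys_iff)
  have q: "q = (\<Sum>e\<in>?K. const4 (?v e) * monom4 e)"
    by (subst R4_sum_monom) (rule sum.mono_neutral_left; auto simp: in_keys_iff)
  note I = is_idealD[OF is_ideal_I4]
  note gens = I4_gens[unfolded var_products]
  have mono: "E * monom4 e \<in> I4" if "E * monom4 e0 \<in> I4" "e = e0 + e'" for E e0 e e'
    using I(4)[OF that(1), of "monom4 e'"] by (simp add: that(2) monom4_add mult.assoc)
  have J1: "pA * monom4 e \<in> I4" if "J1 e" for e
  proof -
    obtain a b c d where e: "e = (a, b, c, d)" by (cases e)
    with that consider "1 \<le> a" "1 \<le> b" | "1 \<le> c" "1 \<le> d" by (auto simp: J_defs)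
    then show ?thesis
      using mono[OF gens(1), of e "(a - 1, b - 1, c, d)"] mono[OF gens(2), of e "(a, b, c - 1, d - 1)"]
      by cases (simp_all add: e)
  qed
  have J2: "pB * monom4 e \<in> I4" if "J2 e" for e
  proof -
    obtain a b c d where e: "e = (a, b, c, d)" by (cases e)
    with that consider "1 \<le> a" "1 \<le> c" | "1 \<le> b" "1 \<le> d" by (auto simp: J_defs)
    then show ?thesis
      using mono[OF gens(3), of e "(a - 1, b, c - 1, d)"] mono[OF gens(4), of e "(a, b - 1, c, d - 1)"]
      by cases (simp_all add: e)
  qed
  have J3: "pC * monom4 e \<in> I4" if "J3 e" for e
  proof -
    obtain a b c d where e: "e = (a, b, c, d)" by (cases e)
    with that consider "1 \<le> a" "1 \<le> d" | "1 \<le> b" "1 \<le> c" by (auto simp: J_defs)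
    then show ?thesis
      using mono[OF gens(5), of e "(a - 1, b, c, d - 1)"] mono[OF gens(6), of e "(a, b - 1, c - 1, d)"]
      by cases (simp_all add: e)
  qed
  have summand: "pB * (const4 (?u e) * monom4 e) + pC * (const4 (?v e) * monom4 e) \<in> I4" for e
  proof -
    have u: "J1 e \<or> J2 e \<or> ?u e = 0"
      using supported_lookup[of p _ e] assms unfolding rep_ok_def JJ_defs by blast
    have v: "J1 e \<or> J3 e \<or> ?v e = 0"
      using supported_lookup[of q _ e] assms unfolding rep_ok_def JJ_defs by blast
    have uv: "J2 e \<or> J3 e \<or> ?u e + ?v e = 0"
      using supported_lookup[of "p + q" _ e] assms unfolding rep_ok_def JJ_defs lookup_add by blast
    have A: "pA * monom4 e = pB * monom4 e - pC * monom4 e"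
      by (simp add: pA_eq algebra_simps)
    then have "pA * monom4 e \<in> I4 \<Longrightarrow> pC * monom4 e \<in> I4 \<Longrightarrow> pB * monom4 e \<in> I4"
      "pA * monom4 e \<in> I4 \<Longrightarrow> pB * monom4 e \<in> I4 \<Longrightarrow> pC * monom4 e \<in> I4"
      using I(2)[of "pA * monom4 e" "pC * monom4 e"] I(6)[of "pB * monom4 e" "pA * monom4 e"]
      by simp_all
    then have both: "pB * monom4 e \<in> I4 \<and> pC * monom4 e \<in> I4"
      if "J1 e \<and> J2 e \<or> J1 e \<and> J3 e \<or> J2 e \<and> J3 e"
      using that J1 J2 J3 by blast
    \<comment> \<open>If at most one of \<open>J1\<close>, \<open>J2\<close>, \<open>J3\<close>
      holds, the conditions make the coefficient pair a multiple of (1, -1), (1, 0) or (0, 1), or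
      zero.\<close>
    consider "J1 e \<and> J2 e \<or> J1 e \<and> J3 e \<or> J2 e \<and> J3 e"
      | "J1 e" "?v e = - ?u e" | "J2 e" "?v e = 0" | "J3 e" "?u e = 0" | "?u e = 0" "?v e = 0"
      using u v uv by (auto simp: eq_neg_iff_add_eq_0 add.commute)
    then show ?thesis
    proof cases
      case 1
      then have "const4 (?u e) * (pB * monom4 e) + const4 (?v e) * (pC * monom4 e) \<in> I4"
        using both by (intro I(2)[OF I(3) I(3)]) blast+
      then show ?thesis by (simp only: mult.left_commute)
    next
      case 2
      then have "pB * (const4 (?u e) * monom4 e) + pC * (const4 (?v e) * monom4 e) = const4 (?u e) * (pA * monom4 e)"
        by (simp add: A algebra_simps)
      then show ?thesis using J1 2 I(3) by simp
    next
      case 3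
      then have "const4 (?u e) * (pB * monom4 e) \<in> I4" using J2 I(3) by blast
      then show ?thesis using 3 by (simp add: mult_ac)
    next
      case 4
      then have "const4 (?v e) * (pC * monom4 e) \<in> I4" using J3 I(3) by blast
      then show ?thesis using 4 by (simp add: mult_ac)
    next
      case 5
      then show ?thesis using I(1) by simp
    qed
  qed
  have "(\<Sum>e\<in>?K. pB * (const4 (?u e) * monom4 e) + pC * (const4 (?v e) * monom4 e)) \<in> I4"
    by (rule is_ideal_sum[OF is_ideal_I4]) (rule summand)
  then have "pB * (\<Sum>e\<in>?K. const4 (?u e) * monom4 e) + pC * (\<Sum>e\<in>?K. const4 (?v e) * monom4 e) \<in> I4"
    by (simp only: sum_distrib_left sum.distrib)
  then show ?thesis by (simp only: p [symmetric] q [symmetric])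
qed

section \<open>Syzygies and torsion modulo \<open>I4\<close>\<close>

lemma syzygyE:
  fixes b c p q :: R4
  assumes "b * p + c * q = 0" "c \<noteq> 0" "\<And>p. c dvd p * b \<Longrightarrow> c dvd p"
  obtains k where "p = c * k" "q = - (b * k)"
proof -
  have "p * b = c * (- q)" using assms(1) by (simp add: eq_neg_iff_add_eq_0 mult.commute)
  then have "c dvd p * b" by simp
  then have "c dvd p" by (rule assms(3))
  then obtain k where k: "p = c * k" by (elim dvdE)
  have "c * (b * k + q) = 0" using assms(1) by (simp add: k algebra_simps)
  then have "b * k + q = 0" using assms(2) by simp
  then have "q = - (b * k)" by (simp add: add_eq_0_iff)
  with k show ?thesis by (rule that)
qed

lemma product_dvd_cancel:
  fixes c1 c2 b p :: R4
  assumes "\<And>p. c1 dvd p * b \<Longrightarrow> c1 dvd p" "\<And>p. c2 dvd p * b \<Longrightarrow> c2 dvd p" "c1 \<noteq> 0" "c1 * c2 dvd p * b"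
  shows "c1 * c2 dvd p"
proof -
  have "c1 dvd p" by (rule assms(1)[OF dvd_mult_left[OF assms(4)]])
  then obtain k where k: "p = c1 * k" by (elim dvdE)
  with assms(3,4) have "c2 dvd k * b" by (simp add: mult.assoc)
  then have "c2 dvd k" by (rule assms(2))
  then show ?thesis by (simp add: k)
qed

text \<open>The linear factors of \<open>pC\<close> are primes that do not divide
  \<open>pB\<close>.\<close>

lemma pB_pC_syzygy:
  assumes "pB * p + pC * q = 0"
  obtains k where "p = pC * k" "q = - (pB * k)"
proof (rule syzygyE[OF assms pABC_nonzero(3)])
  fix p assume "pC dvd p * pB"
  then show "pC dvd p"
    unfolding pC_def
  proof (rule product_dvd_cancel[rotated 3])
    show "varx ^ 4 - varw ^ 4 dvd p" if "varx ^ 4 - varw ^ 4 dvd p * pB" for p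
      by (rule quartic_dvd_cancel[OF prime_elem_lin_x _ that]) (auto simp: lin_x_dvd_iff pB_def)
    show "vary ^ 4 - varz ^ 4 dvd p" if "vary ^ 4 - varz ^ 4 dvd p * pB" for p
      by (rule quartic_dvd_cancel[OF prime_elem_lin_y _ that]) (auto simp: lin_y_dvd_iff pB_def)
  qed simp
qed (use that in blast)

text \<open>After setting x = 0 the two products still have no common prime factor, so the
  restricted relation is a multiple \<open>k\<close> of the obvious syzygy. Subtracting a lift of it
  leaves only terms divisible by x.\<close>

lemma varx_mult_in_pB_pC:
  assumes "varx * g = pB * p + pC * q"
  obtains p' q' where "g = pB * p' + pC * q'"
proof -
  let ?s = "subst4 0 vary varz varw"
  have w: "varw dvd f \<longleftrightarrow> subst4 varx vary varz 0 f = 0" for f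
    by (rule dvd_iff_subst4_eq_0) auto
  have "prime_elem varw"
    by (rule prime_elem_subst4[of _ varx vary varz 0]) auto
  have "?s (varx * g) = ?s (pB * p + pC * q)" by (simp only: assms)
  then have "?s pB * ?s p + ?s pC * ?s q = 0" by simp
  moreover have sC: "?s pC = varw ^ 4 * - (vary ^ 4 - varz ^ 4)"
    by (simp add: pC_def algebra_simps)
  moreover have sB: "?s pB = varz ^ 4 * (varw ^ 4 - vary ^ 4)"
    by (simp add: pB_def algebra_simps)
  moreover have "?s pC dvd p" if "?s pC dvd p * ?s pB" for p
    using that unfolding sC
  proof (rule product_dvd_cancel[rotated 3])
    show "varw ^ 4 dvd p" if "varw ^ 4 dvd p * ?s pB" for p
      using prod_list_dvd_cancel[of "replicate 4 varw" "?s pB" p] that \<open>prime_elem varw\<close>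
      by (simp add: w sB)
    show "- (vary ^ 4 - varz ^ 4) dvd p" if "- (vary ^ 4 - varz ^ 4) dvd p * ?s pB" for p
      using that unfolding minus_dvd_iff
      by (rule quartic_dvd_cancel[OF prime_elem_lin_y, rotated 2]) (auto simp: lin_y_dvd_iff sB)
  qed simp
  moreover have "?s pC \<noteq> 0" unfolding sC by simp
  ultimately obtain k where k: "?s p = ?s pC * k" "?s q = - (?s pB * k)"
    using syzygyE[of "?s pB" "?s p" "?s pC" "?s q"] by blast
  have "varx dvd f - ?s f" for f
    using dvd_subst4_diff[of varx varx 0 vary vary varz varz varw varw f] by simp
  then obtain p1 q1 b1 c1 where "p - ?s p = varx * p1" "q - ?s q = varx * q1"
    "pB - ?s pB = varx * b1" "pC - ?s pC = varx * c1"
    by (metis dvdE)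
  then have "p = ?s p + varx * p1" "q = ?s q + varx * q1" "?s pB = pB - varx * b1"
      "?s pC = pC - varx * c1"
    by (simp_all add: algebra_simps)
  then have p: "p = (pC - varx * c1) * k + varx * p1" and q: "q = - ((pB - varx * b1) * k) + varx * q1"
    using k by metis+
  have "varx * g = varx * (pB * (p1 - c1 * k) + pC * (q1 + b1 * k))"
    unfolding assms p q by (simp add: algebra_simps)
  then show ?thesis by (intro that) simp
qed

text \<open>\<open>J12\<close>, \<open>J13\<close>, \<open>J23\<close> are the intersections of (x,
  w) and (y, z), of (x, z) and (y, w), and of (x, y) and (z, w). Each of these primes omits one of
  x, y, z, which can be cancelled; the check is made on exponents.\<close>

lemma J_cancel:
  assumes "varx * p \<in> J" "vary * p \<in> J" "varz * p \<in> J" "J \<in> {J12, J13, J23}"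
  shows "p \<in> J"
proof -
  have vars: "varx = monom4 (1, 0, 0, 0)" "vary = monom4 (0, 1, 0, 0)" "varz = monom4 (0, 0, 1, 0)"
    by (simp_all add: monom4_conv_var)
  have *: "p \<in> supported U"
    if "varx * p \<in> supported U" "vary * p \<in> supported U" "varz * p \<in> supported U"
      and U: "\<And>a b c d. U (Suc a, b, c, d) \<Longrightarrow> U (a, Suc b, c, d) \<Longrightarrow> U (a, b, Suc c, d) \<Longrightarrow> U (a, b, c, d)" for U
    unfolding supported_def mem_Collect_eq
  proof
    fix e assume e: "e \<in> Poly_Mapping.keys p"
    obtain a b c d where abcd: "e = (a, b, c, d)" by (cases e)
    show "U e"
      using that(1-3)[unfolded vars, THEN supported_monom4_multD, OF e] U by (simp add: abcd)
  qed
  from assms(4) consider "J = J12" | "J = J13" | "J = J23" by blast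
  then show ?thesis
  proof cases
    case 1
    show ?thesis using assms(1-3) unfolding 1 J12_def by (rule *) (auto simp: J_defs)
  next
    case 2
    show ?thesis using assms(1-3) unfolding 2 J13_def by (rule *) (auto simp: J_defs)
  next
    case 3
    show ?thesis using assms(1-3) unfolding 3 J23_def by (rule *) (auto simp: J_defs)
  qed
qed

lemma I4_xyz_torsion_free:
  assumes "varx * g \<in> I4" "vary * g \<in> I4" "varz * g \<in> I4"
  shows "g \<in> I4"
proof -
  obtain p' q' where "varx * g = pB * p' + pC * q'"
    using assms(1) by (rule I4_rep)
  then obtain p q where g: "g = pB * p + pC * q"
    by (rule varx_mult_in_pB_pC)
  \<comment> \<open>Any two representations differ by a multiple of the syzygy
    \<open>(pC, - pB)\<close>, so \<open>rep_ok\<close> passes from the one given by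
    \<open>I4_rep\<close> to this one.\<close>
  have ok: "rep_ok (v * p) (v * q)" if vg: "v * g \<in> I4" for v
  proof -
    obtain p' q' where p'q': "rep_ok p' q'" "v * g = pB * p' + pC * q'"
      using vg by (rule I4_rep)
    then have "pB * (v * p - p') + pC * (v * q - q') = 0"
      by (simp add: g algebra_simps)
    then obtain k where "v * p - p' = pC * k" "v * q - q' = - (pB * k)"
      by (rule pB_pC_syzygy)
    then have "v * p = p' + k * pC" "v * q = q' + k * (- pB)"
      by (simp_all add: algebra_simps)
    then show ?thesis
      using rep_ok_add[OF p'q'(1) rep_ok_mult[OF rep_ok_syzygy, of k]] by simp
  qed
  have "rep_ok p q"
    using ok[OF assms(1)] ok[OF assms(2)] ok[OF assms(3)]
      J_cancel[of p J12] J_cancel[of q J13] J_cancel[of "p + q" J23]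
    unfolding rep_ok_def distrib_left [symmetric] by blast
  then show ?thesis unfolding g by (rule rep_ok_imp_in_I4)
qed

text \<open>No associated prime of \<open>I4\<close> contains three of the variables, hence none is embedded.\<close>

lemma I4_torsion_free:
  assumes "varx * g \<in> I4 \<and> vary * g \<in> I4 \<and> varz * g \<in> I4 \<or> varx * g \<in> I4 \<and> vary * g \<in> I4 \<and> varw * g \<in> I4 \<or>
    varx * g \<in> I4 \<and> varz * g \<in> I4 \<and> varw * g \<in> I4 \<or> vary * g \<in> I4 \<and> varz * g \<in> I4 \<and> varw * g \<in> I4"
  shows "g \<in> I4"
proof -
  note swap = sym_closedD(1-3)[OF sym_closed_I4]
  \<comment> \<open>The remaining triples of variables are reached by successive
    transpositions.\<close>
  have xyw: "g \<in> I4" if "varx * g \<in> I4" "vary * g \<in> I4" "varw * g \<in> I4" for g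
    using swap(3)[OF that(1)] swap(3)[OF that(2)] swap(3)[OF that(3)]
      swap(3)[OF I4_xyz_torsion_free[of "subst4 varx vary varw varz g"]]
    by (simp add: subst4_subst4)
  have xzw: "g \<in> I4" if "varx * g \<in> I4" "varz * g \<in> I4" "varw * g \<in> I4" for g
    using swap(2)[OF that(1)] swap(2)[OF that(2)] swap(2)[OF that(3)]
      swap(2)[OF xyw[of "subst4 varx varz vary varw g"]]
    by (simp add: subst4_subst4)
  have yzw: "g \<in> I4" if "vary * g \<in> I4" "varz * g \<in> I4" "varw * g \<in> I4" for g
    using swap(1)[OF that(1)] swap(1)[OF that(2)] swap(1)[OF that(3)]
      swap(1)[OF xzw[of "subst4 vary varx varz varw g"]]
    by (simp add: subst4_subst4)
  show ?thesis
    using assms I4_xyz_torsion_free xyw xzw yzw by blast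
qed

section \<open>Elements of degree \<open>8 * m\<close> in the symbolic power\<close>

lemma prime_ideal_power: "prime_ideal P \<Longrightarrow> u ^ n \<in> P \<Longrightarrow> u \<in> P"
proof (induction n)
  case 0
  then have "1 \<in> P" by simp
  then have "r * 1 \<in> P" for r using 0 unfolding prime_ideal_def is_ideal_def by blast
  then have "P = UNIV" by auto
  with 0 show ?case by (simp add: prime_ideal_def)
next
  case (Suc n)
  then show ?case by (auto simp: prime_ideal_def)
qed

lemma product_in_symbolic_power:
  assumes abc: "a + b + c = m" "m \<le> 4 * a" "m \<le> 4 * b" "m \<le> 4 * c"
  shows "pA ^ a * pB ^ b * pC ^ c \<in> symbolic_power I4 m"
  unfolding symbolic_power_def
proof (rule INT_I)
  fix P assume "P \<in> associated_primes I4"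
  then obtain g where P: "prime_ideal P" and Pg: "P = ideal_colon I4 g"
    unfolding associated_primes_def by blast
  let ?F = "pA ^ a * pB ^ b * pC ^ c"
  note I = is_idealD[OF is_ideal_I4]
  note power = prime_ideal_power[OF P]
  have prime: "u * v \<notin> P" if "u \<notin> P" "v \<notin> P" for u v
    using that P unfolding prime_ideal_def by blast
  have id: "is_ideal P" using P by (simp add: prime_ideal_def)
  have "1 \<notin> P" using P is_idealD(3)[OF id, of 1] by (auto simp: prime_ideal_def)
  then have three: "\<not> (varx \<in> P \<and> vary \<in> P \<and> varz \<in> P)" "\<not> (varx \<in> P \<and> vary \<in> P \<and> varw \<in> P)"
      "\<not> (varx \<in> P \<and> varz \<in> P \<and> varw \<in> P)" "\<not> (vary \<in> P \<and> varz \<in> P \<and> varw \<in> P)"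
    using I4_torsion_free[of g] by (auto simp: Pg ideal_colon_def)
  have loc: "?F \<in> loc_contract (ideal_pow I4 m) P" if "s \<notin> P" "s ^ n * ?F \<in> ideal_pow I4 m" for s n
    using that power unfolding loc_contract_def by blast
  \<comment> \<open>If P contains at most one variable, the product \<open>s\<close> of three others
    puts all three products into the localised ideal.\<close>
  have one: "?F \<in> loc_contract (ideal_pow I4 m) P"
    if s: "s \<notin> P" "s * pA \<in> I4" "s * pB \<in> I4" "s * pC \<in> I4" for s
  proof (rule loc)
    have "(s * pA) ^ a * (s * pB) ^ b * (s * pC) ^ c \<in> ideal_pow I4 (a + b + c)"
      by (intro mult_in_ideal_pow_add power_in_ideal_pow s)
    then show "s ^ m * ?F \<in> ideal_pow I4 m"
      unfolding abc(1)[symmetric] by (simp add: power_mult_distrib power_add mult_ac)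
  qed (rule s)
  \<comment> \<open>Here \<open>u\<close> and \<open>v\<close> lie in the localised ideal, so
    \<open>E\<close> lies in its fourth power and \<open>E ^ k\<close> in its
    \<open>m\<close>-th.\<close>
  have two: "?F \<in> loc_contract (ideal_pow I4 m) P"
    if s: "s \<notin> P" "s * u \<in> I4" "s * v \<in> I4" and E: "E = (u ^ 4 - v ^ 4) * e" "?F = E ^ k * r" "m \<le> 4 * k"
    for s u v E e k r
  proof (rule loc)
    note I' = is_idealD[OF is_ideal_pow]
    have "s ^ 4 * E = ((s * u) ^ 4 - (s * v) ^ 4) * e"
      by (simp add: E power_mult_distrib algebra_simps)
    also have "\<dots> \<in> ideal_pow I4 4"
      by (intro I' power_in_ideal_pow s)
    finally have "(s ^ 4 * E) ^ k \<in> ideal_pow I4 m"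
      using ideal_pow_antimono[OF E(3)] power_in_ideal_pow_mult by blast
    then have "(s ^ 4 * E) ^ k * r \<in> ideal_pow I4 m" by (rule I')
    then show "s ^ (4 * k) * ?F \<in> ideal_pow I4 m"
      unfolding E(2) by (simp add: power_mult_distrib power_mult [symmetric] mult_ac)
  qed (rule s)
  have A: "?F = pA ^ a * (pB ^ b * pC ^ c)" and B: "?F = pB ^ b * (pA ^ a * pC ^ c)"
    and C: "?F = pC ^ c * (pA ^ a * pB ^ b)"
    by (simp_all add: mult_ac)
  \<comment> \<open>A difference of fourth powers with exactly one of its variables in P is a unit
    at P.\<close>
  have diff: "u ^ 4 - v ^ 4 \<notin> P" "v ^ 4 - u ^ 4 \<notin> P" if "u \<in> P" "v \<notin> P" for u v
  proof -
    have u: "u ^ 4 \<in> P" using is_idealD(3)[OF id that(1), of "u ^ 3"] by (simp add: eval_nat_numeral mult_ac)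
    have v: "v ^ 4 \<notin> P" using power that(2) by blast
    show "u ^ 4 - v ^ 4 \<notin> P" using is_idealD(6)[OF id u, of "u ^ 4 - v ^ 4"] v by auto
    show "v ^ 4 - u ^ 4 \<notin> P" using is_idealD(2)[OF id u, of "v ^ 4 - u ^ 4"] v by auto
  qed
  consider "vary \<notin> P" "varz \<notin> P" "varw \<notin> P" | "varx \<notin> P" "varz \<notin> P" "varw \<notin> P"
    | "varx \<notin> P" "vary \<notin> P" "varw \<notin> P" | "varx \<notin> P" "vary \<notin> P" "varz \<notin> P"
    | "varx \<in> P" "vary \<in> P" "varz \<notin> P" "varw \<notin> P" | "varx \<in> P" "varz \<in> P" "vary \<notin> P" "varw \<notin> P"
    | "varx \<in> P" "varw \<in> P" "vary \<notin> P" "varz \<notin> P" | "vary \<in> P" "varz \<in> P" "varx \<notin> P" "varw \<notin> P"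
    | "vary \<in> P" "varw \<in> P" "varx \<notin> P" "varz \<notin> P" | "varz \<in> P" "varw \<in> P" "varx \<notin> P" "vary \<notin> P"
    using three by blast
  then show "?F \<in> loc_contract (ideal_pow I4 m) P"
  proof cases
    case 1
    then show ?thesis
      using I4_multiples(2)[of vary] I4_multiples(4)[of varz] I4_multiples(6)[of varw]
      by (intro one[of "vary * varz * varw"]) (simp_all add: prime mult_ac)
  next
    case 2
    then show ?thesis
      using I4_multiples(2)[of varx] I4_multiples(3)[of varw] I4_multiples(5)[of varz]
      by (intro one[of "varx * varz * varw"]) (simp_all add: prime mult_ac)
  next
    case 3
    then show ?thesis
      using I4_multiples(1)[of varw] I4_multiples(4)[of varx] I4_multiples(5)[of vary]
      by (intro one[of "varx * vary * varw"]) (simp_all add: prime mult_ac)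
  next
    case 4
    then show ?thesis
      using I4_multiples(1)[of varz] I4_multiples(3)[of vary] I4_multiples(6)[of varx]
      by (intro one[of "varx * vary * varz"]) (simp_all add: prime mult_ac)
  next
    case 5
    \<comment> \<open>Every quartic factor of \<open>pB\<close> pairs a variable in P with one
      outside. Multiplying this element by x or y gives multiples of generators of
      \<open>I4\<close>.\<close>
    then have "pB * (varz * varw) \<notin> P" by (simp add: prime diff pB_def)
    then show ?thesis
      using I4_multiples(3)[of varw] I4_multiples(4)[of varz]
      by (intro two[where s = "pB * (varz * varw)", OF _ _ _ pA_def A abc(2)]) (simp_all add: mult_ac)
  next
    case 6
    then have "pA * (vary * varw) \<notin> P" by (simp add: prime diff pA_def)
    then show ?thesis
      using I4_multiples(1)[of varw] I4_multiples(2)[of vary]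
      by (intro two[where s = "pA * (vary * varw)", OF _ _ _ pB_def B abc(3)]) (simp_all add: mult_ac)
  next
    case 7
    then have "pA * (vary * varz) \<notin> P" by (simp add: prime diff pA_def)
    then show ?thesis
      using I4_multiples(1)[of varz] I4_multiples(2)[of vary]
      by (intro two[where s = "pA * (vary * varz)", OF _ _ _ pC_def C abc(4)]) (simp_all add: mult_ac)
  next
    case 8
    have *: "pC = (vary ^ 4 - varz ^ 4) * (varx ^ 4 - varw ^ 4)" by (simp add: pC_def mult.commute)
    from 8 have "pA * (varx * varw) \<notin> P" by (simp add: prime diff pA_def)
    then show ?thesis
      using I4_multiples(1)[of varw] I4_multiples(2)[of varx]
      by (intro two[where s = "pA * (varx * varw)", OF _ _ _ * C abc(4)]) (simp_all add: mult_ac)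
  next
    case 9
    have *: "pB = (vary ^ 4 - varw ^ 4) * (varx ^ 4 - varz ^ 4)" by (simp add: pB_def mult.commute)
    from 9 have "pA * (varx * varz) \<notin> P" by (simp add: prime diff pA_def)
    then show ?thesis
      using I4_multiples(1)[of varz] I4_multiples(2)[of varx]
      by (intro two[where s = "pA * (varx * varz)", OF _ _ _ * B abc(3)]) (simp_all add: mult_ac)
  next
    case 10
    have *: "pA = (varz ^ 4 - varw ^ 4) * (varx ^ 4 - vary ^ 4)" by (simp add: pA_def mult.commute)
    from 10 have "pB * (varx * vary) \<notin> P" by (simp add: prime diff pB_def)
    then show ?thesis
      using I4_multiples(3)[of vary] I4_multiples(4)[of varx]
      by (intro two[where s = "pB * (varx * vary)", OF _ _ _ * A abc(2)]) (simp_all add: mult_ac)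
  qed
qed

theorem theorem3p3:
  fixes m :: nat
  assumes "m \<ge> 3" and "m \<noteq> 5"
  shows "alpha (symbolic_power I4 m) = 8 * m"
  unfolding alpha_def
proof (rule Least_equality)
  \<comment> \<open>\<open>t\<close> is m/4 rounded up, the least exponent allowed for each product.
    Three such exponents fit into \<open>m\<close> exactly when \<open>m\<close> is not 1, 2 or 5
    (for positive \<open>m\<close>); the surplus goes to \<open>pA\<close>.\<close>
  define t where "t = (m + 3) div 4"
  have t: "3 * t \<le> m" "m \<le> 4 * t" using assms unfolding t_def by presburger+
  let ?F = "pA ^ (m - 2 * t) * pB ^ t * pC ^ t"
  have "?F \<in> symbolic_power I4 m"
    using t by (intro product_in_symbolic_power) auto
  moreover have "?F \<noteq> 0" by (simp add: pABC_nonzero)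
  moreover have "homogeneous_of_degree ?F (8 * (m - 2 * t) + 8 * t + 8 * t)"
    by (intro homogeneous_mult homogeneous_power homogeneous_pABC)
  moreover have "8 * (m - 2 * t) + 8 * t + 8 * t = 8 * m" using t by simp
  ultimately show "\<exists>f\<in>symbolic_power I4 m. f \<noteq> 0 \<and> homogeneous_of_degree f (8 * m)"
    by metis
qed (use symbolic_power_I4_degree in blast)

end
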